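(* There exist $\varepsilon>0$ and a constant $c\in[1/2,1-\varepsilon]$ such that $\operatorname{sat}(k)\le 2^{(1-\varepsilon)k}$ for every positive integer $k$ and $\operatorname{sat}(k)=2^{(1+o(1))ck}$ as $k\to\infty$.
   Context: For a set $X$, a collection $\mathcal{F}\subseteq\mathcal{P}(X)$ is a $k$-Sperner system if it contains no $(k+1)$-chain, i.e. no sets $A_1\subsetneq\dots\subsetneq A_{k+1}$ all in $\mathcal{F}$. It is a saturated $k$-Sperner system if it is a $k$-Sperner system and for every $S\in\mathcal{P}(X)\setminus\mathcal{F}$ the collection $\mathcal{F}\cup\{S\}$ contains a $(k+1)$-chain. $\operatorname{sat}(n,k)$ denotes the minimum size of a saturated $k$-Sperner system in $\mathcal{P}(X)$ with $|X|=n$; for fixed $k$ it is constant for all sufficiently large $n$, and $\operatorname{sat}(k):=\lim_{n\to\infty}\operatorname{sat}(n,k)$. *)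

theory Defs
  imports Complex_Main "HOL-Library.Landau_Symbols"
begin

definition has_chain :: "nat \<Rightarrow> 'a set set \<Rightarrow> bool" where
  "has_chain m F \<longleftrightarrow>
     (\<exists>A :: nat \<Rightarrow> 'a set. (\<forall>i\<in>{1..m}. A i \<in> F) \<and> (\<forall>i\<in>{1..<m}. A i \<subset> A (Suc i)))"

definition Sperner_system :: "nat \<Rightarrow> 'a set \<Rightarrow> 'a set set \<Rightarrow> bool" where
  "Sperner_system k X F \<longleftrightarrow> F \<subseteq> Pow X \<and> \<not> has_chain (k + 1) F"

definition saturated_Sperner_system :: "nat \<Rightarrow> 'a set \<Rightarrow> 'a set set \<Rightarrow> bool" where
  "saturated_Sperner_system k X F \<longleftrightarrow>
     Sperner_system k X F \<and> (\<forall>S\<in>Pow X - F. has_chain (k + 1) (F \<union> {S}))"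

text \<open>The set below is a nonempty set of natural numbers (a maximal \<open>k\<close>-Sperner system in
  \<open>Pow X\<close> always exists), so its infimum is attained.  Every finite cardinality is realised by a
  set of natural numbers, so no ground set is lost by restricting to them.\<close>

definition sat :: "nat \<Rightarrow> nat \<Rightarrow> nat" where
  "sat n k = Inf {card F | (X :: nat set) F.
     finite X \<and> card X = n \<and> saturated_Sperner_system k X F}"

definition sat_lim :: "nat \<Rightarrow> real" where
  "sat_lim k = lim (\<lambda>n. real (sat n k))"

end

theory Submission imports Defs begin

text \<open>
  A family with few sets on a huge ground set has a homogeneous block: a set \<open>H\<close> of at least two
  points which no member splits.  Such a family is described on \<open>Y = X - H\<close> by its small members
  \<open>S\<close> (disjoint from \<open>H\<close>) and its large members \<open>L\<close> (containing \<open>H\<close>, with \<open>H\<close> removed), and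
  it is a saturated \<open>k\<close>-Sperner system iff for every \<open>T \<subseteq> Y\<close> the longest chain of \<open>S\<close> below \<open>T\<close>
  and the longest chain of \<open>L\<close> above \<open>T\<close> have \<open>k\<close> members in total.  This does not mention \<open>|H|\<close>,
  so \<open>sat n k\<close> is eventually constant.

  The condition is stable under products: taking unions of small with small and large with large
  members gives a saturated \<open>(k\<^sub>1 + k\<^sub>2 - 2)\<close>-Sperner system, so \<open>log sat (k + 2)\<close> is subadditive
  and Fekete's lemma yields \<open>c\<close>.  The intervals between the tops of the chains below \<open>T\<close> and the
  bottoms of those above \<open>T\<close> cover the cube and have codimension at least \<open>k - 2\<close>; hence
  \<open>|S| |L| \<ge> 2 ^ (k - 2)\<close> and \<open>c \<ge> 1/2\<close>.  A 6-Sperner system with 15 small and 15 large members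
  beats the value 32 of the Boolean construction, and its powers give \<open>c < 1\<close>.
\<close>

section \<open>Chains as strictly increasing lists, and heights of finite families\<close>

text \<open>Lists can be concatenated, mapped and reversed, which is how chains are glued below. The
  indexed form compares only neighbours, so transitivity has to supply the remaining pairs.\<close>

lemma has_chain_iff_list:
  "has_chain m F \<longleftrightarrow> (\<exists>xs. length xs = m \<and> set xs \<subseteq> F \<and> sorted_wrt (\<subset>) xs)"
proof
  assume "has_chain m F"
  then obtain A where A: "\<forall>i\<in>{1..m}. A i \<in> F" "\<forall>i\<in>{1..<m}. A i \<subset> A (Suc i)"
    unfolding has_chain_def by blast
  have lt: "A i \<subset> A (i + Suc d)" if "1 \<le> i" "i + Suc d \<le> m" for i d
    using that
  proof (induction d)
    case 0
    then show ?case using A(2) by auto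
  next
    case (Suc d)
    then have "A i \<subset> A (i + Suc d)" by auto
    moreover have "A (i + Suc d) \<subset> A (Suc (i + Suc d))" using A(2) Suc.prems by auto
    ultimately show ?case by auto
  qed
  have "sorted_wrt (\<subset>) (map A [1..<Suc m])"
    unfolding sorted_wrt_iff_nth_less
  proof (intro allI impI)
    fix i j assume "i < j" "j < length (map A [1..<Suc m])"
    then show "map A [1..<Suc m] ! i \<subset> map A [1..<Suc m] ! j"
      using lt[of "Suc i" "j - i - 1"] by (simp del: upt_Suc)
  qed
  moreover have "set (map A [1..<Suc m]) \<subseteq> F" using A(1) by (auto simp del: upt_Suc)
  moreover have "length (map A [1..<Suc m]) = m" by simp
  ultimately show "\<exists>xs. length xs = m \<and> set xs \<subseteq> F \<and> sorted_wrt (\<subset>) xs" by blast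
next
  assume "\<exists>xs. length xs = m \<and> set xs \<subseteq> F \<and> sorted_wrt (\<subset>) xs"
  then obtain xs where xs: "length xs = m" "set xs \<subseteq> F" "sorted_wrt (\<subset>) xs" by blast
  have "\<forall>i\<in>{1..m}. xs ! (i - 1) \<in> F" using xs(1,2) by (auto intro!: subsetD[OF xs(2)] nth_mem)
  moreover have "\<forall>i\<in>{1..<m}. xs ! (i - 1) \<subset> xs ! (Suc i - 1)"
    using xs(1,3) by (auto simp: sorted_wrt_iff_nth_less)
  ultimately show "has_chain m F" unfolding has_chain_def by (intro exI[of _ "\<lambda>i. xs ! (i - 1)"]) simp
qed

lemma has_chainI_list: "\<lbrakk>set xs \<subseteq> F; sorted_wrt (\<subset>) xs; length xs = m\<rbrakk> \<Longrightarrow> has_chain m F"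
  unfolding has_chain_iff_list by blast

lemma has_chainE_list:
  assumes "has_chain m F"
  obtains xs where "length xs = m" "set xs \<subseteq> F" "sorted_wrt (\<subset>) xs"
  using assms unfolding has_chain_iff_list by blast

lemma has_chain_mono: "has_chain m F \<Longrightarrow> F \<subseteq> G \<Longrightarrow> has_chain m G"
  unfolding has_chain_def by blast

lemma has_chain_le: "has_chain m F \<Longrightarrow> l \<le> m \<Longrightarrow> has_chain l F"
  by (elim has_chainE_list, rule has_chainI_list[of "take l _"])
     (auto simp: sorted_wrt_take dest: in_set_takeD)

lemma sorted_psubset_distinct: "sorted_wrt (\<subset>) xs \<Longrightarrow> distinct xs"
  by (induction xs) auto

text \<open>A strictly increasing rank takes distinct values along a chain, and only
  \<open>k\<close> values are available.\<close>

lemma no_chain_if_ranked: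
  fixes g :: "'a set \<Rightarrow> nat"
  assumes mono: "\<And>A B. A \<in> F \<Longrightarrow> B \<in> F \<Longrightarrow> A \<subset> B \<Longrightarrow> g A < g B"
    and range: "\<And>A. A \<in> F \<Longrightarrow> 1 \<le> g A \<and> g A \<le> k"
  shows "\<not> has_chain (k + 1) F"
proof
  assume "has_chain (k + 1) F"
  then obtain xs where xs: "length xs = k + 1" "set xs \<subseteq> F" "sorted_wrt (\<subset>) xs"
    by (rule has_chainE_list)
  have "sorted_wrt (<) (map g xs)"
    unfolding sorted_wrt_map using xs(3)
    by (rule sorted_wrt_mono_rel[rotated]) (use xs(2) mono in blast)
  then have "distinct (map g xs)" using strict_sorted_iff by blast
  then have "card (set (map g xs)) = k + 1" using xs(1) distinct_card by fastforce
  moreover have "set (map g xs) \<subseteq> {1..k}" using xs(2) range by auto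
  then have "card (set (map g xs)) \<le> k" using card_mono[of "{1..k}"] by fastforce
  ultimately show False by simp
qed

lemma has_chain_card_le:
  assumes "has_chain m F" "finite F" shows "m \<le> card F"
  using assms by (auto elim!: has_chainE_list dest!: sorted_psubset_distinct simp: distinct_card[symmetric] card_mono)

definition height :: "'a set set \<Rightarrow> nat" where
  "height F = (GREATEST m. has_chain m F)"

text \<open>Truncation makes the chain lengths an initial segment and \<open>card F\<close> bounds
  them, so one number records them all.\<close>

lemma has_chain_iff_height:
  assumes "finite F" shows "has_chain m F \<longleftrightarrow> m \<le> height F"
proof -
  have 0: "has_chain 0 F" by (simp add: has_chain_iff_list)
  have bound: "\<forall>m. has_chain m F \<longrightarrow> m \<le> card F" using has_chain_card_le assms by blast
  have "has_chain (height F) F" unfolding height_def by (rule GreatestI_nat[where k = 0 and b = "card F"]) (use 0 bound in blast)+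
  moreover have "m \<le> height F" if "has_chain m F" for m
    unfolding height_def by (rule Greatest_le_nat[where b = "card F"]) (use that bound in blast)+
  ultimately show ?thesis using has_chain_le by blast
qed

definition height_below :: "'a set set \<Rightarrow> 'a set \<Rightarrow> nat" where
  "height_below F T = height {A\<in>F. A \<subseteq> T}"

context
  fixes F :: "'a set set"
  assumes fin: "finite F"
begin

lemma le_height_below: "m \<le> height_below F T \<longleftrightarrow> has_chain m {A\<in>F. A \<subseteq> T}"
  unfolding height_below_def using fin by (simp add: has_chain_iff_height)

lemma height_below_mono: "T \<subseteq> U \<Longrightarrow> height_below F T \<le> height_below F U"
  by (subst le_height_below, rule has_chain_mono[where F = "{A\<in>F. A \<subseteq> T}"])
     (auto simp: le_height_below[symmetric])

lemma height_below_psubset: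
  assumes "B \<in> F" "T \<subset> B" shows "height_below F T < height_below F B"
proof -
  obtain xs where xs: "length xs = height_below F T" "set xs \<subseteq> {A\<in>F. A \<subseteq> T}" "sorted_wrt (\<subset>) xs"
    using le_height_below[of "height_below F T" T] by (auto elim: has_chainE_list)
  have "has_chain (Suc (height_below F T)) {A\<in>F. A \<subseteq> B}"
    by (rule has_chainI_list[of "xs @ [B]"]) (use xs assms in \<open>auto simp: sorted_wrt_append\<close>)
  then show ?thesis by (simp add: le_height_below[symmetric] Suc_le_eq)
qed

text \<open>The witness is the top of a longest chain below \<open>T\<close>, since the whole chain
  lies below its top.\<close>

lemma height_below_attained:
  assumes "1 \<le> height_below F T"
  obtains A where "A \<in> F" "A \<subseteq> T" "height_below F A = height_below F T"
proof -
  obtain xs where xs: "length xs = height_below F T" "set xs \<subseteq> {A\<in>F. A \<subseteq> T}" "sorted_wrt (\<subset>) xs"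
    using le_height_below[of "height_below F T" T] by (auto elim: has_chainE_list)
  then obtain ys A where ys: "xs = ys @ [A]" using assms by (cases xs rule: rev_cases) auto
  have "has_chain (height_below F T) {B\<in>F. B \<subseteq> A}"
    by (rule has_chainI_list[of xs]) (use xs ys in \<open>auto simp: sorted_wrt_append\<close>)
  then have "height_below F T \<le> height_below F A" by (simp add: le_height_below)
  then show ?thesis using that[of A] xs ys height_below_mono[of A T] by auto
qed

text \<open>The witness is the second set from the top of a longest chain. Dropping the top loses at
  most one, and \<open>height_below_psubset\<close> says that at least one is lost.\<close>

lemma height_below_step:
  assumes "A \<in> F" "2 \<le> height_below F A"
  obtains B where "B \<in> F" "B \<subset> A" "Suc (height_below F B) = height_below F A"
proof -
  obtain xs where xs: "length xs = height_below F A" "set xs \<subseteq> {B\<in>F. B \<subseteq> A}" "sorted_wrt (\<subset>) xs"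
    using le_height_below[of "height_below F A" A] by (auto elim: has_chainE_list)
  then obtain ys C where ys: "xs = ys @ [C]" using assms by (cases xs rule: rev_cases) auto
  then obtain zs B where zs: "ys = zs @ [B]" using xs(1) assms by (cases ys rule: rev_cases) auto
  have "has_chain (height_below F A - 1) {D\<in>F. D \<subseteq> B}"
    by (rule has_chainI_list[of ys]) (use xs ys zs in \<open>auto simp: sorted_wrt_append\<close>)
  then have "height_below F A - 1 \<le> height_below F B" by (simp add: le_height_below)
  moreover have "B \<in> F" "B \<subset> A" using xs ys zs by (auto simp: sorted_wrt_append)
  moreover have "height_below F B < height_below F A"
    using height_below_psubset assms(1) \<open>B \<subset> A\<close> by blast
  ultimately show ?thesis using that[of B] by linarith
qed

end

section \<open>Systems with a homogeneous block\<close>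

text \<open>\<open>r T\<close> is the length of a longest chain of \<open>S\<close> below \<open>T\<close>, and \<open>k - r T\<close> that of a longest
  chain of \<open>L\<close> above \<open>T\<close>; both are required to be positive, i.e. \<open>{} \<in> S\<close> and \<open>Y \<in> L\<close>.  Stating
  this by local conditions on \<open>r\<close> avoids all reasoning about chains in products.\<close>

locale pair_system =
  fixes k :: nat and Y :: "'a set" and S L :: "'a set set" and r :: "'a set \<Rightarrow> nat"
  assumes finite_ground: "finite Y"
    and small_sub: "S \<subseteq> Pow Y"
    and large_sub: "L \<subseteq> Pow Y"
    and rank_pos: "T \<subseteq> Y \<Longrightarrow> 1 \<le> r T"
    and rank_less: "T \<subseteq> Y \<Longrightarrow> r T < k"
    and rank_mono: "T \<subseteq> U \<Longrightarrow> U \<subseteq> Y \<Longrightarrow> r T \<le> r U"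
    and small_strict: "A \<in> S \<Longrightarrow> B \<in> S \<Longrightarrow> A \<subset> B \<Longrightarrow> r A < r B"
    and large_strict: "A \<in> L \<Longrightarrow> B \<in> L \<Longrightarrow> A \<subset> B \<Longrightarrow> r A < r B"
    and small_attained: "T \<subseteq> Y \<Longrightarrow> \<exists>A\<in>S. A \<subseteq> T \<and> r A = r T"
    and large_attained: "T \<subseteq> Y \<Longrightarrow> \<exists>B\<in>L. T \<subseteq> B \<and> r B = r T"
    and small_step: "A \<in> S \<Longrightarrow> 2 \<le> r A \<Longrightarrow> \<exists>B\<in>S. B \<subset> A \<and> Suc (r B) = r A"
    and large_step: "A \<in> L \<Longrightarrow> r A + 2 \<le> k \<Longrightarrow> \<exists>B\<in>L. A \<subset> B \<and> r B = Suc (r A)"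
begin

lemma finite_small: "finite S" and finite_large: "finite L"
  using small_sub large_sub finite_ground by (auto intro: finite_subset)

text \<open>Iterating \<open>small_step\<close> descends one rank at a time to rank 1, so the local
  conditions on \<open>r\<close> yield an actual chain.\<close>

lemma chain_below:
  "A \<in> S \<Longrightarrow> \<exists>xs. length xs = r A \<and> set xs \<subseteq> {B\<in>S. B \<subseteq> A} \<and> sorted_wrt (\<subset>) xs"
proof (induction "r A" arbitrary: A rule: less_induct)
  case less
  show ?case
  proof (cases "2 \<le> r A")
    case True
    then obtain B where B: "B \<in> S" "B \<subset> A" "Suc (r B) = r A" using small_step less.prems by blast
    then obtain xs where "length xs = r B" "set xs \<subseteq> {C\<in>S. C \<subseteq> B}" "sorted_wrt (\<subset>) xs"
      using less.hyps[of B] by auto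
    then show ?thesis using B less.prems
      by (intro exI[of _ "xs @ [A]"]) (auto simp: sorted_wrt_append)
  next
    case False
    then have "r A = 1" using rank_pos[of A] less.prems small_sub by fastforce
    then show ?thesis using less.prems by (intro exI[of _ "[A]"]) auto
  qed
qed

text \<open>Dually, iterating \<open>large_step\<close> climbs to rank \<open>k - 1\<close>, which
  accounts for \<open>k - r A\<close> sets.\<close>

lemma chain_above:
  "A \<in> L \<Longrightarrow> \<exists>xs. length xs = k - r A \<and> set xs \<subseteq> {B\<in>L. A \<subseteq> B} \<and> sorted_wrt (\<subset>) xs"
proof (induction "k - r A" arbitrary: A rule: less_induct)
  case less
  show ?case
  proof (cases "r A + 2 \<le> k")
    case True
    then obtain B where B: "B \<in> L" "A \<subset> B" "r B = Suc (r A)" using large_step less.prems by blast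
    moreover have "k - r B < k - r A" using B(3) True by linarith
    ultimately obtain xs where "length xs = k - r B" "set xs \<subseteq> {C\<in>L. B \<subseteq> C}" "sorted_wrt (\<subset>) xs"
      using less.hyps[of B] by blast
    then show ?thesis using B less.prems True
      by (intro exI[of _ "A # xs"]) auto
  next
    case False
    then have "k - r A = 1" using rank_less[of A] less.prems large_sub by fastforce
    then show ?thesis using less.prems by (intro exI[of _ "[A]"]) auto
  qed
qed

text \<open>A new set \<open>Z\<close> is completed through its trace on \<open>Y\<close>: with
  \<open>i = r (Z \<inter> Y)\<close> there are \<open>i\<close> small sets below \<open>Z\<close>
  and \<open>k - i\<close> large ones above it, whatever \<open>Z\<close> does on
  \<open>H\<close>.\<close>

lemma blow_up_saturated:
  assumes "Y \<inter> H = {}" "H \<noteq> {}"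
  shows "saturated_Sperner_system k (Y \<union> H) (S \<union> (\<lambda>B. B \<union> H) ` L)"
proof -
  let ?F = "S \<union> (\<lambda>B. B \<union> H) ` L"
  \<comment> \<open>A small set may lie below a large one with the same \<open>r\<close>, so ranks
    of large members are shifted up by one; all values still lie in \<open>{1..k}\<close>.\<close>
  define g where "g Z = (if Z \<inter> H = {} then r Z else Suc (r (Z - H)))" for Z
  have gS: "g A = r A" "A \<subseteq> Y" "A \<inter> H = {}" if "A \<in> S" for A
    using that assms small_sub by (auto simp: g_def)
  have gL: "g (B \<union> H) = Suc (r B)" "B \<subseteq> Y" "B \<inter> H = {}" if "B \<in> L" for B
  proof -
    show B: "B \<subseteq> Y" using that large_sub by auto
    then show "B \<inter> H = {}" using assms by auto
    then have "B \<union> H - H = B" by auto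
    then show "g (B \<union> H) = Suc (r B)" using assms(2) by (auto simp: g_def)
  qed
  have "\<not> has_chain (k + 1) ?F"
  proof (rule no_chain_if_ranked[of _ g])
    fix A B assume "A \<in> ?F" "B \<in> ?F" "A \<subset> B"
    then consider "A \<in> S" "B \<in> S" | B' where "A \<in> S" "B' \<in> L" "B = B' \<union> H"
      | A' B' where "A' \<in> L" "A = A' \<union> H" "B' \<in> L" "B = B' \<union> H"
      | A' where "A' \<in> L" "A = A' \<union> H" "B \<in> S" by blast
    then show "g A < g B"
    proof cases
      case 1
      then show ?thesis using small_strict \<open>A \<subset> B\<close> gS by auto
    next
      case 2
      then have "A \<subseteq> B'" using \<open>A \<subset> B\<close> gS(3) by blast
      then have "r A \<le> r B'" using rank_mono gL(2) 2 by blast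
      then show ?thesis using gS gL 2 by auto
    next
      case 3
      then have "A' \<subset> B'" using \<open>A \<subset> B\<close> gL(3)[of A'] gL(3)[of B'] by blast
      then show ?thesis using large_strict 3 gL by auto
    next
      case 4
      then show ?thesis using \<open>A \<subset> B\<close> assms gS(3)[of B] by blast
    qed
  next
    fix A assume "A \<in> ?F"
    then show "1 \<le> g A \<and> g A \<le> k"
      using gS gL rank_pos rank_less by (auto simp: Suc_le_eq less_imp_le)
  qed
  moreover have "?F \<subseteq> Pow (Y \<union> H)" using small_sub large_sub by blast
  moreover have "has_chain (k + 1) (?F \<union> {Z})" if Z: "Z \<in> Pow (Y \<union> H) - ?F" for Z
  proof -
    obtain A where A: "A \<in> S" "A \<subseteq> Z \<inter> Y" "r A = r (Z \<inter> Y)" using small_attained[of "Z \<inter> Y"] by auto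
    obtain B where B: "B \<in> L" "Z \<inter> Y \<subseteq> B" "r B = r (Z \<inter> Y)" using large_attained[of "Z \<inter> Y"] by auto
    obtain xs where xs: "length xs = r A" "set xs \<subseteq> {B\<in>S. B \<subseteq> A}" "sorted_wrt (\<subset>) xs"
      using chain_below[OF A(1)] by blast
    obtain ys where ys: "length ys = k - r B" "set ys \<subseteq> {C\<in>L. B \<subseteq> C}" "sorted_wrt (\<subset>) ys"
      using chain_above[OF B(1)] by blast
    \<comment> \<open>Inclusion is strict here and in the next line because \<open>Z\<close> is not
      in the family.\<close>
    have lt1: "C \<subset> Z" if "C \<in> set xs" for C using that xs(2) A Z by blast
    have lt2: "Z \<subset> C \<union> H" if "C \<in> set ys" for C using that ys(2) B Z by blast
    have "sorted_wrt (\<subset>) (map (\<lambda>B. B \<union> H) ys)"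
      unfolding sorted_wrt_map using ys(3)
      by (rule sorted_wrt_mono_rel[rotated]) (use ys(2) gL(3) in blast)
    then have "sorted_wrt (\<subset>) (xs @ Z # map (\<lambda>B. B \<union> H) ys)"
      using xs(3) lt1 lt2 by (fastforce simp: sorted_wrt_append)
    moreover have "length (xs @ Z # map (\<lambda>B. B \<union> H) ys) = k + 1"
      using xs(1) ys(1) A(3) B(3) rank_less[of "Z \<inter> Y"] by simp
    moreover have "set (xs @ Z # map (\<lambda>B. B \<union> H) ys) \<subseteq> ?F \<union> {Z}" using xs(2) ys(2) by auto
    ultimately show ?thesis by (intro has_chainI_list) auto
  qed
  ultimately show ?thesis unfolding saturated_Sperner_system_def Sperner_system_def by blast
qed

lemma card_blow_up:
  assumes "Y \<inter> H = {}" "H \<noteq> {}"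
  shows "card (S \<union> (\<lambda>B. B \<union> H) ` L) = card S + card L"
proof -
  have "inj_on (\<lambda>B. B \<union> H) L" using assms(1) large_sub by (intro inj_onI) blast
  then show ?thesis
    using assms small_sub by (subst card_Un_disjoint) (auto simp: finite_small finite_large card_image)
qed

end

section \<open>Complementation, and adjoining the empty set and the ground set\<close>

lemma saturatedD:
  assumes "saturated_Sperner_system k X F"
  shows "F \<subseteq> Pow X" "\<not> has_chain (k + 1) F"
    "\<And>Z. Z \<subseteq> X \<Longrightarrow> Z \<notin> F \<Longrightarrow> has_chain (k + 1) (insert Z F)"
  using assms unfolding saturated_Sperner_system_def Sperner_system_def by auto

lemma saturatedI:
  assumes "F \<subseteq> Pow X" "\<not> has_chain (k + 1) F"
    "\<And>Z. Z \<subseteq> X \<Longrightarrow> Z \<notin> F \<Longrightarrow> has_chain (k + 1) (insert Z F)"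
  shows "saturated_Sperner_system k X F"
  using assms unfolding saturated_Sperner_system_def Sperner_system_def by auto

lemma has_chain_compl:
  assumes "has_chain m F" "F \<subseteq> Pow X"
  shows "has_chain m ((-) X ` F)"
proof -
  obtain xs where xs: "length xs = m" "set xs \<subseteq> F" "sorted_wrt (\<subset>) xs"
    using assms(1) by (rule has_chainE_list)
  have "sorted_wrt (\<lambda>A B. X - B \<subset> X - A) xs"
    using xs(3) by (rule sorted_wrt_mono_rel[rotated]) (use xs(2) assms(2) in blast)
  then have "sorted_wrt (\<subset>) (rev (map ((-) X) xs))" by (simp add: sorted_wrt_rev sorted_wrt_map)
  then show ?thesis using xs by (intro has_chainI_list[of "rev (map ((-) X) xs)"]) auto
qed

lemma compl_compl_image: "F \<subseteq> Pow X \<Longrightarrow> (-) X ` (-) X ` F = F"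
  unfolding image_image by (simp add: subset_iff double_diff cong: image_cong)

text \<open>Complementation is an order-reversing involution of \<open>Pow X\<close>, so it maps
  chains to chains both ways. It turns statements about the empty set into statements about
  \<open>X\<close>.\<close>

lemma saturated_compl:
  assumes "saturated_Sperner_system k X F"
  shows "saturated_Sperner_system k X ((-) X ` F)"
proof (rule saturatedI)
  note F = saturatedD[OF assms]
  show "(-) X ` F \<subseteq> Pow X" by auto
  then show "\<not> has_chain (k + 1) ((-) X ` F)"
    using has_chain_compl[of "k + 1" "(-) X ` F" X] F(2) compl_compl_image[OF F(1)] by auto
  fix Z assume Z: "Z \<subseteq> X" "Z \<notin> (-) X ` F"
  then have "X - Z \<notin> F" by (metis double_diff image_eqI order_refl)
  then have "has_chain (k + 1) (insert (X - Z) F)" using F(3) by auto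
  then have "has_chain (k + 1) ((-) X ` insert (X - Z) F)" using F(1) by (intro has_chain_compl) auto
  then show "has_chain (k + 1) (insert Z ((-) X ` F))" using Z(1) by (simp add: double_diff)
qed

text \<open>The bottoms of the \<open>k\<close>-chains form an antichain, which is traded for the empty set.\<close>

lemma saturated_insert_empty:
  assumes sat: "saturated_Sperner_system k X F" and fin: "finite X" and k: "2 \<le> k"
  obtains F' where "saturated_Sperner_system k X F'" "{} \<in> F'" "card F' \<le> card F"
    "X \<in> F \<Longrightarrow> X \<in> F'"
proof (cases "{} \<in> F")
  case True
  then show ?thesis using that sat by blast
next
  case False
  note F = saturatedD[OF sat]
  have finF: "finite F" using F(1) fin by (meson finite_Pow_iff finite_subset)
  \<comment> \<open>The set \<open>A\<close> is counted in the \<open>k\<close>-chain, hence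
    \<open>xs\<close> has \<open>k - 1\<close> members.\<close>
  define bot where "bot A \<longleftrightarrow> (\<exists>xs. Suc (length xs) = k \<and> set (A # xs) \<subseteq> F \<and> sorted_wrt (\<subset>) (A # xs))" for A
  define F' where "F' = insert {} (F - {A. bot A})"
  have no: "\<not> (set xs \<subseteq> F \<and> sorted_wrt (\<subset>) xs \<and> length xs = k + 1)" for xs
    using F(2) has_chainI_list by blast
  \<comment> \<open>Prepending \<open>A\<close> to a \<open>k\<close>-chain that starts at
    \<open>B\<close> would give \<open>k + 1\<close> members of \<open>F\<close>.\<close>
  have above_not_bot: "\<not> bot B" if "A \<in> F" "A \<subset> B" for A B
  proof
    assume "bot B"
    then obtain xs where xs: "Suc (length xs) = k" "set (B # xs) \<subseteq> F" "sorted_wrt (\<subset>) (B # xs)"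
      unfolding bot_def by blast
    then have "sorted_wrt (\<subset>) (A # B # xs)" using that by auto
    then show False using no[of "A # B # xs"] xs that by auto
  qed
  have botI: "bot A" if "set (A # xs) \<subseteq> F" "sorted_wrt (\<subset>) (A # xs)" "Suc (length xs) = k" for A xs
    using that unfolding bot_def by blast
  have "saturated_Sperner_system k X F'"
  proof (rule saturatedI)
    show "F' \<subseteq> Pow X" using F(1) by (auto simp: F'_def)
    show "\<not> has_chain (k + 1) F'"
    proof
      \<comment> \<open>Only the first set of such a chain can be empty. The other \<open>k\<close>
        lie in \<open>F\<close> and make the second set a bottom, but bottoms were removed.\<close>
      assume "has_chain (k + 1) F'"
      then obtain zs where zs: "length zs = k + 1" "set zs \<subseteq> F'" "sorted_wrt (\<subset>) zs"
        by (rule has_chainE_list)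
      then obtain z w ws where eq: "zs = z # w # ws" using k by (cases zs; cases "tl zs") auto
      have ne: "\<forall>A\<in>set (w # ws). A \<noteq> {}" using zs(3) eq by auto
      then have "set (w # ws) \<subseteq> F - {A. bot A}" using zs(2) eq by (auto simp: F'_def)
      moreover have "bot w" by (rule botI[of w ws]) (use calculation zs eq in auto)
      ultimately show False by auto
    qed
  next
    fix Z assume Z: "Z \<subseteq> X" "Z \<notin> F'"
    then have Z0: "Z \<noteq> {}" by (auto simp: F'_def)
    \<comment> \<open>A removed bottom is completed by its own \<open>k\<close>-chain with
      \<open>{}\<close> in front. Otherwise, in the chain that \<open>Z\<close> completes over
      \<open>F\<close>, only the lowest member of \<open>F\<close> can be a removed bottom, and
      \<open>{}\<close> at the front replaces it.\<close>
    show "has_chain (k + 1) (insert Z F')"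
    proof (cases "Z \<in> F")
      case True
      then have "bot Z" using Z by (auto simp: F'_def)
      then obtain xs where xs: "Suc (length xs) = k" "set (Z # xs) \<subseteq> F" "sorted_wrt (\<subset>) (Z # xs)"
        unfolding bot_def by blast
      then have "set xs \<subseteq> F'" using above_not_bot[of Z] by (auto simp: F'_def)
      then show ?thesis using xs Z0
        by (intro has_chainI_list[of "{} # Z # xs"]) (auto simp: F'_def)
    next
      case False
      then have "has_chain (k + 1) (insert Z F)" using F(3) Z(1) by blast
      then obtain zs where zs: "length zs = k + 1" "set zs \<subseteq> insert Z F" "sorted_wrt (\<subset>) zs"
        by (rule has_chainE_list)
      then obtain z w ws where eq: "zs = z # w # ws" using k by (cases zs; cases "tl zs") auto
      show ?thesis
      proof (cases "z = Z")
        case True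
        then have sub: "set (w # ws) \<subseteq> F" using zs(2,3) eq by auto
        then have "set ws \<subseteq> F'" using above_not_bot[of w] zs(3) eq by (auto simp: F'_def)
        then show ?thesis using zs eq True Z0
          by (intro has_chainI_list[of "{} # Z # ws"]) (auto simp: F'_def)
      next
        case False
        then have "z \<in> F" using zs eq by auto
        then have "set (w # ws) \<subseteq> insert Z F'" using above_not_bot[of z] zs eq by (auto simp: F'_def)
        then show ?thesis using zs eq
          by (intro has_chainI_list[of "{} # w # ws"]) (auto simp: F'_def)
      qed
    qed
  qed
  moreover have "{} \<in> F'" by (simp add: F'_def)
  \<comment> \<open>Adjoining \<open>{}\<close> is paid for by a removed bottom: the chain that
    \<open>{}\<close> completes over \<open>F\<close> contains a \<open>k\<close>-chain of
    \<open>F\<close>.\<close>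
  moreover have "card F' \<le> card F"
  proof -
    have "has_chain (k + 1) (insert {} F)" using F(3) \<open>{} \<notin> F\<close> by blast
    then obtain zs where zs: "length zs = k + 1" "set zs \<subseteq> insert {} F" "sorted_wrt (\<subset>) zs"
      by (rule has_chainE_list)
    then obtain z w ws where eq: "zs = z # w # ws" using k by (cases zs; cases "tl zs") auto
    have "set (w # ws) \<subseteq> F" using zs eq by auto
    then have "bot w" "w \<in> F" using botI[of w ws] zs eq by auto
    then have "F - {A. bot A} \<subset> F" by blast
    then have "card (F - {A. bot A}) < card F" using finF psubset_card_mono by blast
    then show ?thesis unfolding F'_def using finF
      by (metis Suc_leI card_insert_if finite_Diff less_imp_le)
  qed
  moreover have "X \<in> F'" if "X \<in> F"
  proof -
    \<comment> \<open>No member lies strictly above \<open>X\<close>, so a chain starting there has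
      one member, fewer than \<open>k\<close>.\<close>
    have "\<not> bot X"
    proof
      assume "bot X"
      then obtain xs where "Suc (length xs) = k" "set (X # xs) \<subseteq> F" "sorted_wrt (\<subset>) (X # xs)"
        unfolding bot_def by blast
      then show False using k F(1) by (cases xs) auto
    qed
    then show ?thesis using that by (auto simp: F'_def)
  qed
  ultimately show ?thesis using that by blast
qed

text \<open>The exchange is made twice, the second time on the complements. There
  \<open>{} \<in> G\<close> has become membership of \<open>X\<close>, which the exchange
  preserves.\<close>

lemma saturated_insert_empty_full:
  assumes sat: "saturated_Sperner_system k X F" and fin: "finite X" and k: "2 \<le> k"
  obtains F' where "saturated_Sperner_system k X F'" "{} \<in> F'" "X \<in> F'" "card F' \<le> card F"
proof -
  obtain G where G: "saturated_Sperner_system k X G" "{} \<in> G" "card G \<le> card F"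
    using saturated_insert_empty[OF assms] by metis
  have finG: "finite G" using saturatedD(1)[OF G(1)] fin by (meson finite_Pow_iff finite_subset)
  have "X \<in> (-) X ` G" using G(2) by force
  then obtain K where K: "saturated_Sperner_system k X K" "{} \<in> K" "X \<in> K" "card K \<le> card ((-) X ` G)"
    using saturated_insert_empty[OF saturated_compl[OF G(1)] fin k] by metis
  have "card K \<le> card F" using K(4) G(3) card_image_le[OF finG, of "(-) X"] by linarith
  then show ?thesis using that K by blast
qed

text \<open>A set \<open>insert x T\<close> splits the block, hence is not in \<open>F\<close>; the chain that it completes shows
  that the two heights at \<open>T\<close> add up to \<open>k\<close>.\<close>

lemma pair_system_of_homogeneous:
  fixes X :: "'a set"
  assumes sat: "saturated_Sperner_system k X F" and fin: "finite X"
    and F0: "{} \<in> F" and FX: "X \<in> F" and xy: "x \<in> X" "y \<in> X" "x \<noteq> y"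
    and hom: "\<And>A. A \<in> F \<Longrightarrow> x \<in> A \<longleftrightarrow> y \<in> A"
  shows "\<exists>Y S L r. pair_system k (Y :: 'a set) S L r \<and> card S + card L = card F"
proof -
  note F = saturatedD[OF sat]
  define Y where "Y = X - {x, y}"
  define S where "S = {A\<in>F. x \<notin> A}"
  define L where "L = (\<lambda>A. A - {x, y}) ` {A\<in>F. x \<in> A}"
  \<comment> \<open>Complementing in \<open>Y\<close> turns chains of \<open>L\<close> above
    \<open>T\<close> into chains below \<open>Y - T\<close>, so the facts on
    \<open>height_below\<close> serve both sides.\<close>
  define L' where "L' = (-) Y ` L"
  define r where "r = height_below S"
  define l where "l T = height_below L' (Y - T)" for T
  have finF: "finite F" using F(1) fin by (meson finite_Pow_iff finite_subset)
  then have finS: "finite S" and finL: "finite L" and finL': "finite L'" by (auto simp: S_def L_def L'_def)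
  have subS: "S \<subseteq> Pow Y" using F(1) hom by (auto simp: S_def Y_def)
  have subL: "L \<subseteq> Pow Y" using F(1) by (auto simp: L_def Y_def)
  have L_iff: "B \<in> L \<longleftrightarrow> B \<union> {x, y} \<in> F" if "B \<subseteq> Y" for B
  proof
    assume "B \<in> L"
    then obtain A where "A \<in> F" "x \<in> A" "B = A - {x, y}" by (auto simp: L_def)
    moreover have "B \<union> {x, y} = A" using calculation hom by auto
    ultimately show "B \<union> {x, y} \<in> F" by simp
  next
    assume "B \<union> {x, y} \<in> F"
    moreover have "B = (B \<union> {x, y}) - {x, y}" using that by (auto simp: Y_def)
    ultimately show "B \<in> L" unfolding L_def by blast
  qed
  have compl: "Y - B \<in> L'" if "B \<in> L" for B using that by (auto simp: L'_def)
  have rl: "r T + l T = k" if T: "T \<subseteq> Y" for T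
  proof (rule antisym)
    obtain xs where xs: "length xs = r T" "set xs \<subseteq> {A\<in>S. A \<subseteq> T}" "sorted_wrt (\<subset>) xs"
      using le_height_below[OF finS, of "r T" T] by (auto simp: r_def elim: has_chainE_list)
    obtain ys where ys: "length ys = l T" "set ys \<subseteq> {A\<in>L'. A \<subseteq> Y - T}" "sorted_wrt (\<subset>) ys"
      using le_height_below[OF finL', of "l T" "Y - T"] by (auto simp: l_def elim: has_chainE_list)
    \<comment> \<open>This returns from \<open>L'\<close> to the members of \<open>F\<close> that
      contain the block. It reverses inclusion, hence the \<open>rev\<close> below.\<close>
    let ?up = "\<lambda>A. (Y - A) \<union> {x, y}"
    have up: "Y - A \<in> L" "A \<subseteq> Y" if "A \<in> L'" for A
      using that subL by (auto simp: L'_def double_diff)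
    have "sorted_wrt (\<lambda>A B. ?up B \<subset> ?up A) ys"
      using ys(3)
    proof (rule sorted_wrt_mono_rel[rotated])
      fix A B assume "A \<in> set ys" "B \<in> set ys" "A \<subset> B"
      moreover have "B \<subseteq> Y" using calculation ys(2) up(2) by blast
      moreover have "x \<notin> Y" "y \<notin> Y" by (auto simp: Y_def)
      ultimately show "?up B \<subset> ?up A" by blast
    qed
    then have "sorted_wrt (\<subset>) (rev (map ?up ys))" by (simp add: sorted_wrt_rev sorted_wrt_map)
    moreover have "A \<subset> ?up B" if "A \<in> set xs" "B \<in> set ys" for A B
    proof -
      have "A \<subseteq> T" using that(1) xs(2) by blast
      moreover have "B \<subseteq> Y - T" using that(2) ys(2) by blast
      ultimately have "A \<subseteq> ?up B" using T by blast
      moreover have "x \<notin> A" using \<open>A \<subseteq> T\<close> T by (auto simp: Y_def)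
      ultimately show ?thesis by blast
    qed
    ultimately have "sorted_wrt (\<subset>) (xs @ rev (map ?up ys))"
      using xs(3) by (simp add: sorted_wrt_append)
    moreover have "?up A \<in> F" if "A \<in> set ys" for A
      using that ys(2) up(1)[of A] L_iff[of "Y - A"] by blast
    then have "set (xs @ rev (map ?up ys)) \<subseteq> F" using xs(2) by (auto simp: S_def)
    ultimately have "has_chain (r T + l T) F"
      using xs(1) ys(1) by (intro has_chainI_list[of "xs @ rev (map ?up ys)"]) auto
    then show "r T + l T \<le> k" using F(2) has_chain_le[of "r T + l T" F "k + 1"] by linarith
  next
    let ?Z = "insert x T"
    have "?Z \<notin> F" using hom[of ?Z] xy T by (auto simp: Y_def)
    moreover have "?Z \<subseteq> X" using T xy by (auto simp: Y_def)
    ultimately have "has_chain (k + 1) (insert ?Z F)" using F(3) by blast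
    then obtain zs where zs: "length zs = k + 1" "set zs \<subseteq> insert ?Z F" "sorted_wrt (\<subset>) zs"
      by (rule has_chainE_list)
    \<comment> \<open>Otherwise \<open>F\<close> alone would have a \<open>(k + 1)\<close>-chain.
      Sets before \<open>?Z\<close> omit \<open>y\<close>, hence also \<open>x\<close>; sets after
      it contain \<open>x\<close>, hence also \<open>y\<close>.\<close>
    have "?Z \<in> set zs" using zs F(2) has_chainI_list[of zs F] by blast
    then obtain us vs where eq: "zs = us @ ?Z # vs" by (meson split_list)
    have us: "A \<in> F \<and> A \<subset> ?Z" if "A \<in> set us" for A using that zs eq by (auto simp: sorted_wrt_append)
    have vs: "A \<in> F \<and> ?Z \<subset> A" if "A \<in> set vs" for A using that zs eq by (auto simp: sorted_wrt_append)
    have us': "A \<in> S \<and> A \<subseteq> T" if "A \<in> set us" for A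
    proof -
      have "y \<notin> A" using us[OF that] T xy by (auto simp: Y_def)
      then show ?thesis using us[OF that] hom by (auto simp: S_def)
    qed
    have "has_chain (length us) {A\<in>S. A \<subseteq> T}"
      by (rule has_chainI_list[of us]) (use us' zs eq in \<open>auto simp: sorted_wrt_append\<close>)
    then have 1: "length us \<le> r T" by (simp add: r_def le_height_below[OF finS])
    let ?dn = "\<lambda>A. Y - (A - {x, y})"
    have vs': "A \<subseteq> X" "x \<in> A" "y \<in> A" "T \<subseteq> A" "A - {x, y} \<in> L" if "A \<in> set vs" for A
    proof -
      have A: "A \<in> F" "insert x T \<subset> A" using vs[OF that] by auto
      show "A \<subseteq> X" using A(1) F(1) by blast
      show x: "x \<in> A" "T \<subseteq> A" using A(2) by auto
      show "y \<in> A" using hom[OF A(1)] x by blast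
      show "A - {x, y} \<in> L" using A(1) x unfolding L_def by blast
    qed
    have "sorted_wrt (\<subset>) vs" using zs eq by (auto simp: sorted_wrt_append)
    then have "sorted_wrt (\<lambda>A B. ?dn B \<subset> ?dn A) vs"
    proof (rule sorted_wrt_mono_rel[rotated])
      fix A B assume "A \<in> set vs" "B \<in> set vs" "A \<subset> B"
      moreover obtain z where "z \<in> B" "z \<notin> A" using \<open>A \<subset> B\<close> by blast
      moreover have "z \<in> Y" using vs'(1-3)[of A] vs'(1)[of B] calculation by (auto simp: Y_def)
      moreover have "z \<notin> {x, y}" using \<open>z \<in> Y\<close> by (simp add: Y_def)
      ultimately show "?dn B \<subset> ?dn A" by blast
    qed
    then have "sorted_wrt (\<subset>) (rev (map ?dn vs))" by (simp add: sorted_wrt_rev sorted_wrt_map)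
    moreover have "set (rev (map ?dn vs)) \<subseteq> {A\<in>L'. A \<subseteq> Y - T}"
    proof
      fix B assume "B \<in> set (rev (map ?dn vs))"
      then obtain A where A: "A \<in> set vs" "B = ?dn A" by auto
      have "B \<in> L'" using compl[OF vs'(5)[OF A(1)]] A(2) by simp
      moreover have "B \<subseteq> Y - T" using vs'(4)[OF A(1)] T A(2) by (auto simp: Y_def)
      ultimately show "B \<in> {A\<in>L'. A \<subseteq> Y - T}" by blast
    qed
    ultimately have "has_chain (length vs) {A\<in>L'. A \<subseteq> Y - T}"
      by (intro has_chainI_list[of "rev (map ?dn vs)"]) auto
    then have 2: "length vs \<le> l T" by (simp add: l_def le_height_below[OF finL'])
    show "k \<le> r T + l T" using 1 2 zs(1) eq by simp
  qed
  \<comment> \<open>The members \<open>{}\<close> and \<open>X\<close> of \<open>F\<close> supply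
    one-element chains, which make both heights positive.\<close>
  have r1: "1 \<le> r T" for T
    unfolding r_def by (subst le_height_below[OF finS], rule has_chainI_list[of "[{}]"])
      (use F0 in \<open>auto simp: S_def\<close>)
  have YL: "Y \<in> L" using FX xy unfolding L_def Y_def by blast
  have l1: "1 \<le> l T" for T
    unfolding l_def by (subst le_height_below[OF finL'], rule has_chainI_list[of "[{}]"])
      (use compl[OF YL] in auto)
  have "pair_system k Y S L r"
  proof
    show "finite Y" using fin by (simp add: Y_def)
    show "S \<subseteq> Pow Y" "L \<subseteq> Pow Y" by fact+
    show "1 \<le> r T" for T by (rule r1)
    show "r T < k" if "T \<subseteq> Y" for T using rl[OF that] l1[of T] by linarith
    show "r T \<le> r U" if "T \<subseteq> U" for T U using height_below_mono[OF finS that] by (simp add: r_def)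
    show "r A < r B" if "A \<in> S" "B \<in> S" "A \<subset> B" for A B
      using height_below_psubset[OF finS that(2,3)] by (simp add: r_def)
    show "r A < r B" if "A \<in> L" "B \<in> L" "A \<subset> B" for A B
    proof -
      have "A \<subseteq> Y" "B \<subseteq> Y" using that subL by auto
      moreover have "Y - B \<subset> Y - A" using that calculation by blast
      then have "l B < l A" unfolding l_def using height_below_psubset[OF finL' compl[OF that(1)]] by blast
      ultimately show ?thesis using rl[of A] rl[of B] by linarith
    qed
    show "\<exists>A\<in>S. A \<subseteq> T \<and> r A = r T" for T
      using height_below_attained[OF finS, of T] r1[of T] by (metis r_def)
    show "\<exists>B\<in>L. T \<subseteq> B \<and> r B = r T" if T: "T \<subseteq> Y" for T
    proof -
      obtain A where A: "A \<in> L'" "A \<subseteq> Y - T" "height_below L' A = l T"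
        using height_below_attained[OF finL', of "Y - T"] l1[of T] by (metis l_def)
      then obtain B where B: "B \<in> L" "A = Y - B" by (auto simp: L'_def)
      then have "B \<subseteq> Y" using subL by auto
      moreover have "l B = l T" using A B by (simp add: l_def)
      moreover have "T \<subseteq> B" using A(2) B(2) T by auto
      ultimately show ?thesis using B(1) rl[of B] rl[OF T] by auto
    qed
    show "\<exists>B\<in>S. B \<subset> A \<and> Suc (r B) = r A" if "A \<in> S" "2 \<le> r A" for A
      using height_below_step[OF finS that(1)] that(2) by (metis r_def)
    show "\<exists>B\<in>L. A \<subset> B \<and> r B = Suc (r A)" if A: "A \<in> L" "r A + 2 \<le> k" for A
    proof -
      have AY: "A \<subseteq> Y" using A subL by auto
      have "2 \<le> height_below L' (Y - A)" using rl[OF AY] A(2) by (simp add: l_def)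
      then obtain C where C: "C \<in> L'" "C \<subset> Y - A" "Suc (height_below L' C) = l A"
        using height_below_step[OF finL' compl[OF A(1)]] by (metis l_def)
      then obtain B where B: "B \<in> L" "C = Y - B" by (auto simp: L'_def)
      then have "B \<subseteq> Y" using subL by auto
      moreover have "Suc (l B) = l A" using C B by (simp add: l_def)
      moreover have "A \<subset> B" using C(2) B(2) AY by auto
      ultimately show ?thesis using B(1) rl[of B] rl[OF AY] by auto
    qed
  qed
  moreover have "card S + card L = card F"
  proof -
    have "inj_on (\<lambda>A. A - {x, y}) {A\<in>F. x \<in> A}"
    proof (rule inj_onI)
      fix A B assume "A \<in> {A\<in>F. x \<in> A}" "B \<in> {A\<in>F. x \<in> A}" "A - {x, y} = B - {x, y}"
      then show "A = B" using hom[of A] hom[of B] by blast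
    qed
    then have "card L = card {A\<in>F. x \<in> A}" by (simp add: L_def card_image)
    moreover have "card F = card S + card {A\<in>F. x \<in> A}"
      using finF by (subst card_Un_disjoint[symmetric]) (auto simp: S_def intro: arg_cong[of _ _ card])
    ultimately show ?thesis by simp
  qed
  ultimately show ?thesis by blast
qed

text \<open>Pigeonhole on the map sending a point to the set of members containing it, which has at
  most \<open>2 ^ card F\<close> values.\<close>

lemma ex_homogeneous_pair:
  assumes "finite X" "finite F" "2 ^ card F < card X"
  obtains x y where "x \<in> X" "y \<in> X" "x \<noteq> y" "\<And>A. A \<in> F \<Longrightarrow> x \<in> A \<longleftrightarrow> y \<in> A"
proof -
  let ?f = "\<lambda>x. {A\<in>F. x \<in> A}"
  have "card (?f ` X) \<le> card (Pow F)" using assms(2) by (intro card_mono) auto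
  then have "\<not> inj_on ?f X" using assms(2,3) by (auto simp: card_image card_Pow)
  then obtain x y where "x \<in> X" "y \<in> X" "x \<noteq> y" "?f x = ?f y" unfolding inj_on_def by blast
  then show ?thesis using that[of x y] by blast
qed

section \<open>The least size of a pair system as the eventual value of \<open>sat\<close>\<close>

text \<open>Meaningful for \<open>2 \<le> k\<close> only: the rank bounds at the empty set exclude
  smaller \<open>k\<close>.\<close>

definition pair_sat :: "nat \<Rightarrow> nat" where
  "pair_sat k = (LEAST m. \<exists>(Y :: nat set) S L r. pair_system k Y S L r \<and> m = card S + card L)"

lemma pair_sat_le: "pair_system k (Y :: nat set) S L r \<Longrightarrow> pair_sat k \<le> card S + card L"
  unfolding pair_sat_def by (rule Least_le) blast

text \<open>The full cube of dimension \<open>k - 2\<close> shows that pair systems exist and gives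
  the bound \<open>2 ^ (k - 1)\<close>. The successor puts the ranks into
  \<open>{1..k - 1}\<close>.\<close>

lemma pair_system_boolean:
  assumes "2 \<le> k"
  shows "pair_system k {..<k - 2} (Pow {..<k - 2}) (Pow {..<k - 2}) (\<lambda>T. Suc (card T))"
proof
  fix T assume T: "T \<subseteq> {..<k - 2}"
  then have "card T \<le> k - 2" using card_mono[of "{..<k - 2}" T] by simp
  then show "Suc (card T) < k" using assms by linarith
next
  fix T U :: "nat set" assume "T \<subseteq> U" "U \<subseteq> {..<k - 2}"
  then show "Suc (card T) \<le> Suc (card U)" by (simp add: card_mono finite_subset)
next
  fix A B :: "nat set" assume "B \<in> Pow {..<k - 2}" "A \<subset> B"
  then show "Suc (card A) < Suc (card B)" by (auto intro: psubset_card_mono finite_subset)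
next
  fix A assume A: "A \<in> Pow {..<k - 2}" "2 \<le> Suc (card A)"
  then obtain a where a: "a \<in> A" by fastforce
  have "finite A" using A finite_subset by auto
  then show "\<exists>B\<in>Pow {..<k - 2}. B \<subset> A \<and> Suc (Suc (card B)) = Suc (card A)"
    using A a by (intro bexI[of _ "A - {a}"]) (auto simp: card_Suc_Diff1 simp del: card_Diff_insert)
next
  fix A assume A: "A \<in> Pow {..<k - 2}" "Suc (card A) + 2 \<le> k"
  then have fA: "finite A" using finite_subset by auto
  have "A \<noteq> {..<k - 2}" using A(2) by auto
  then obtain a where "a \<in> {..<k - 2} - A" using A by blast
  then show "\<exists>B\<in>Pow {..<k - 2}. A \<subset> B \<and> Suc (card B) = Suc (Suc (card A))"
    using A fA by (intro bexI[of _ "insert a A"]) auto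
qed auto

lemma pair_sat_attained:
  assumes "2 \<le> k"
  obtains Y S L r where "pair_system k (Y :: nat set) S L r" "pair_sat k = card S + card L"
proof -
  have "\<exists>(Y :: nat set) S L r. pair_system k Y S L r \<and> pair_sat k = card S + card L"
    unfolding pair_sat_def by (rule LeastI_ex) (use pair_system_boolean[OF assms] in blast)
  then show ?thesis using that by blast
qed

lemma pair_sat_le_power:
  assumes "2 \<le> k" shows "pair_sat k \<le> 2 ^ (k - 1)"
proof -
  have "pair_sat k \<le> 2 ^ (k - 2) + 2 ^ (k - 2)"
    using pair_sat_le[OF pair_system_boolean[OF assms]] by (simp add: card_Pow)
  also have "\<dots> = 2 ^ (k - 1)" using assms by (metis Suc_1 Suc_diff_Suc Suc_le_lessD mult_2 power_Suc)
  finally show ?thesis .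
qed

text \<open>Blowing up an optimal pair system bounds \<open>sat\<close> from above. Conversely a
  smaller saturated system would have a homogeneous pair and so give a smaller pair system.\<close>

lemma sat_eq_pair_sat:
  assumes k: "2 \<le> k"
  shows "\<forall>\<^sub>F n in sequentially. sat n k = pair_sat k"
proof -
  obtain Y S L r where ps: "pair_system k (Y :: nat set) S L r" and eq: "pair_sat k = card S + card L"
    using pair_sat_attained[OF k] .
  interpret pair_system k Y S L r by fact
  \<comment> \<open>The first threshold leaves points for a nonempty block; the second forces a
    homogeneous pair in every family with fewer than \<open>pair_sat k\<close> members.\<close>
  have "sat n k = pair_sat k" if n: "n > card Y" "n > 2 ^ pair_sat k" for n
    unfolding sat_def
  proof (rule cInf_eq_minimum)
    obtain H where H: "finite H" "card H = n - card Y" "H \<subseteq> - Y"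
      using infinite_arbitrarily_large[of "- Y" "n - card Y"] finite_ground
      by (auto simp: Compl_eq_Diff_UNIV)
    have disj: "Y \<inter> H = {}" "H \<noteq> {}" using H n(1) by auto
    have "card (Y \<union> H) = n" using H n(1) disj finite_ground by (simp add: card_Un_disjoint)
    then show "pair_sat k \<in> {card F |X F. finite X \<and> card X = n \<and> saturated_Sperner_system k (X :: nat set) F}"
      using blow_up_saturated[OF disj] card_blow_up[OF disj, symmetric] finite_ground H(1)
      unfolding eq mem_Collect_eq by blast
  next
    fix m assume "m \<in> {card F |X F. finite X \<and> card X = n \<and> saturated_Sperner_system k (X :: nat set) F}"
    then obtain X :: "nat set" and F where X: "m = card F" "finite X" "card X = n"
      "saturated_Sperner_system k X F" by blast
    show "pair_sat k \<le> m"
    proof (rule ccontr)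
      assume less: "\<not> pair_sat k \<le> m"
      obtain F' where F': "saturated_Sperner_system k X F'" "{} \<in> F'" "X \<in> F'" "card F' \<le> card F"
        using saturated_insert_empty_full[OF X(4,2) k] .
      have "finite F'" using saturatedD(1)[OF F'(1)] X(2) by (meson finite_Pow_iff finite_subset)
      moreover have "(2::nat) ^ card F' \<le> 2 ^ pair_sat k"
        using F'(4) less X(1) by (intro power_increasing) auto
      then have "2 ^ card F' < card X" using n(2) X(3) by linarith
      ultimately obtain x y where "x \<in> X" "y \<in> X" "x \<noteq> y" "\<And>A. A \<in> F' \<Longrightarrow> x \<in> A \<longleftrightarrow> y \<in> A"
        using ex_homogeneous_pair[OF X(2)] by metis
      then obtain Y' S' L' r' where "pair_system k (Y' :: nat set) S' L' r'" "card S' + card L' = card F'"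
        using pair_system_of_homogeneous[OF F'(1) X(2) F'(2,3)] by metis
      then show False using pair_sat_le F'(4) less X(1) by fastforce
    qed
  qed
  then show ?thesis
    by (auto simp: eventually_sequentially intro!: exI[of _ "Suc (card Y + 2 ^ pair_sat k)"])
qed

lemma sat_lim_eq_pair_sat: "2 \<le> k \<Longrightarrow> sat_lim k = real (pair_sat k)"
  unfolding sat_lim_def
  using sat_eq_pair_sat[of k] by (intro limI tendsto_eventually) (auto elim: eventually_mono)

text \<open>This case is outside the range of pair systems. The family \<open>{{}}\<close> is
  saturated, while the empty family is not, as one set is no 2-chain.\<close>

lemma sat_lim_one: "sat_lim 1 = 1"
proof -
  have "sat n 1 = 1" for n
    unfolding sat_def
  proof (rule cInf_eq_minimum)
    have "saturated_Sperner_system 1 {..<n} {{}}"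
    proof (rule saturatedI)
      show "\<not> has_chain (1 + 1) {{} :: nat set}"
        by (rule no_chain_if_ranked[of _ "\<lambda>_. 1"]) auto
      show "has_chain (1 + 1) {Z, {}}" if "Z \<notin> {{}}" for Z :: "nat set"
        by (rule has_chainI_list[of "[{}, Z]"]) (use that in auto)
    qed auto
    moreover have "card {{} :: nat set} = 1" by simp
    ultimately show "1 \<in> {card F |X F. finite X \<and> card X = n \<and> saturated_Sperner_system 1 (X :: nat set) F}"
      by (metis (mono_tags, lifting) card_lessThan finite_lessThan mem_Collect_eq)
  next
    fix m assume "m \<in> {card F |X F. finite X \<and> card X = n \<and> saturated_Sperner_system 1 (X :: nat set) F}"
    then obtain X :: "nat set" and F where X: "m = card F" "finite X" "saturated_Sperner_system 1 X F" by blast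
    have "finite F" using saturatedD(1)[OF X(3)] X(2) by (meson finite_Pow_iff finite_subset)
    moreover have "F \<noteq> {}"
    proof
      assume "F = {}"
      then have "has_chain (1 + 1) {{} :: nat set}" using saturatedD(3)[OF X(3), of "{}"] by simp
      then show False using has_chain_card_le by fastforce
    qed
    ultimately show "1 \<le> m" using X(1) by (simp add: Suc_le_eq card_gt_0_iff)
  qed
  then show ?thesis unfolding sat_lim_def by simp
qed

section \<open>Products and the lower bound\<close>

text \<open>Transport along an injection, needed to make ground sets inside the naturals disjoint
  before forming a product.\<close>

lemma pair_system_image:
  assumes "pair_system k Y S L r" and inj: "inj_on e Y"
  shows "pair_system k (e ` Y) (image e ` S) (image e ` L) (\<lambda>T. r {y\<in>Y. e y \<in> T})"
    "card (image e ` S) = card S" "card (image e ` L) = card L"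
proof -
  interpret pair_system k Y S L r by fact
  define pre where "pre T = {y\<in>Y. e y \<in> T}" for T
  have pre_sub: "pre T \<subseteq> Y" for T by (auto simp: pre_def)
  have pre_mono: "T \<subseteq> U \<Longrightarrow> pre T \<subseteq> pre U" for T U by (auto simp: pre_def)
  have pre_img: "pre (e ` A) = A" if "A \<subseteq> Y" for A
    using that inj by (auto simp: pre_def inj_on_def)
  have img_pre: "e ` pre T = T" if "T \<subseteq> e ` Y" for T
    using that by (auto simp: pre_def)
  have preS: "pre (e ` A) = A" if "A \<in> S" for A using that small_sub pre_img by blast
  have preL: "pre (e ` A) = A" if "A \<in> L" for A using that large_sub pre_img by blast
  have psub: "A \<subset> B" if "e ` A \<subset> e ` B" "pre (e ` A) = A" "pre (e ` B) = B" for A B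
    using that pre_mono[of "e ` A" "e ` B"] by auto
  have psub': "e ` A \<subset> e ` B" if "A \<subset> B" "pre (e ` A) = A" "pre (e ` B) = B" for A B
  proof (rule psubsetI)
    show "e ` A \<subseteq> e ` B" using that(1) by (intro image_mono) auto
    show "e ` A \<noteq> e ` B" using that by (metis less_irrefl)
  qed
  have "pair_system k (e ` Y) (image e ` S) (image e ` L) (\<lambda>T. r (pre T))"
  proof
    show "finite (e ` Y)" using finite_ground by simp
    show "image e ` S \<subseteq> Pow (e ` Y)" "image e ` L \<subseteq> Pow (e ` Y)" using small_sub large_sub by blast+
    show "1 \<le> r (pre T)" for T using rank_pos pre_sub by blast
    show "r (pre T) < k" for T using rank_less pre_sub by blast
    show "r (pre T) \<le> r (pre U)" if "T \<subseteq> U" for T U by (rule rank_mono[OF pre_mono[OF that] pre_sub])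
    show "r (pre A) < r (pre B)" if AB: "A \<in> image e ` S" "B \<in> image e ` S" "A \<subset> B" for A B
    proof -
      obtain A' B' where "A' \<in> S" "A = e ` A'" "B' \<in> S" "B = e ` B'" using AB(1,2) by blast
      then show ?thesis using small_strict[of A' B'] psub[of A' B'] preS AB(3) by simp
    qed
    show "r (pre A) < r (pre B)" if AB: "A \<in> image e ` L" "B \<in> image e ` L" "A \<subset> B" for A B
    proof -
      obtain A' B' where "A' \<in> L" "A = e ` A'" "B' \<in> L" "B = e ` B'" using AB(1,2) by blast
      then show ?thesis using large_strict[of A' B'] psub[of A' B'] preL AB(3) by simp
    qed
    show "\<exists>A\<in>image e ` S. A \<subseteq> T \<and> r (pre A) = r (pre T)" if T: "T \<subseteq> e ` Y" for T
    proof -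
      obtain A where A: "A \<in> S" "A \<subseteq> pre T" "r A = r (pre T)" using small_attained[OF pre_sub] by blast
      moreover have "e ` A \<subseteq> T" using A(2) by (auto simp: pre_def)
      ultimately show ?thesis using preS[OF A(1)] by (intro bexI[of _ "e ` A"]) auto
    qed
    show "\<exists>B\<in>image e ` L. T \<subseteq> B \<and> r (pre B) = r (pre T)" if T: "T \<subseteq> e ` Y" for T
    proof -
      obtain B where B: "B \<in> L" "pre T \<subseteq> B" "r B = r (pre T)" using large_attained[OF pre_sub] by blast
      moreover have "T \<subseteq> e ` B" using B(2) img_pre[OF T] by blast
      ultimately show ?thesis using preL[OF B(1)] by (intro bexI[of _ "e ` B"]) auto
    qed
    show "\<exists>B\<in>image e ` S. B \<subset> A \<and> Suc (r (pre B)) = r (pre A)"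
      if A: "A \<in> image e ` S" "2 \<le> r (pre A)" for A
    proof -
      obtain A' where A': "A' \<in> S" "A = e ` A'" using A by blast
      then obtain B where B: "B \<in> S" "B \<subset> A'" "Suc (r B) = r A'" using small_step A preS by metis
      then have "e ` B \<subset> A" using A' psub'[of B A'] preS by simp
      then show ?thesis using A' B preS by (intro bexI[of _ "e ` B"]) auto
    qed
    show "\<exists>B\<in>image e ` L. A \<subset> B \<and> r (pre B) = Suc (r (pre A))"
      if A: "A \<in> image e ` L" "r (pre A) + 2 \<le> k" for A
    proof -
      obtain A' where A': "A' \<in> L" "A = e ` A'" using A by blast
      then obtain B where B: "B \<in> L" "A' \<subset> B" "r B = Suc (r A')" using large_step A preL by metis
      then have "A \<subset> e ` B" using A' psub'[of A' B] preL by simp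
      then show ?thesis using A' B preL by (intro bexI[of _ "e ` B"]) auto
    qed
  qed
  then show "pair_system k (e ` Y) (image e ` S) (image e ` L) (\<lambda>T. r {y\<in>Y. e y \<in> T})"
    by (simp add: pre_def)
  show "card (image e ` S) = card S" "card (image e ` L) = card L"
    using preS preL by (metis card_image inj_on_inverseI)+
qed

definition joins :: "'a set set \<Rightarrow> 'a set set \<Rightarrow> 'a set set" where
  "joins F G = (\<lambda>(A, B). A \<union> B) ` (F \<times> G)"

text \<open>The shifted rank \<open>r - 1\<close> ranges over \<open>{0..k - 2}\<close> and adds
  under products; this explains \<open>k1 + k2 - 2\<close> and the final \<open>- 1\<close>.\<close>

lemma pair_system_joins:
  assumes "pair_system k1 Y1 S1 L1 r1" "pair_system k2 Y2 S2 L2 r2" and disj: "Y1 \<inter> Y2 = {}"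
  shows "pair_system (k1 + k2 - 2) (Y1 \<union> Y2) (joins S1 S2) (joins L1 L2)
           (\<lambda>T. r1 (T \<inter> Y1) + r2 (T \<inter> Y2) - 1)"
    "card (joins S1 S2) = card S1 * card S2" "card (joins L1 L2) = card L1 * card L2"
proof -
  interpret p1: pair_system k1 Y1 S1 L1 r1 by fact
  interpret p2: pair_system k2 Y2 S2 L2 r2 by fact
  let ?r = "\<lambda>T. r1 (T \<inter> Y1) + r2 (T \<inter> Y2) - 1"
  have Int: "(A \<union> B) \<inter> Y1 = A" "(A \<union> B) \<inter> Y2 = B" if "A \<subseteq> Y1" "B \<subseteq> Y2" for A B
    using that disj by auto
  have joinsE: "\<exists>A B. A \<in> F \<and> B \<in> G \<and> C = A \<union> B \<and> C \<inter> Y1 = A \<and> C \<inter> Y2 = B"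
    if C: "C \<in> joins F G" and FG: "F \<subseteq> Pow Y1" "G \<subseteq> Pow Y2" for C F G
  proof -
    obtain A B where "A \<in> F" "B \<in> G" "C = A \<union> B" using C unfolding joins_def by blast
    then show ?thesis using Int[of A B] FG by blast
  qed
  have joinsI: "A \<union> B \<in> joins F G" if "A \<in> F" "B \<in> G" for A B F G
    using that by (auto simp: joins_def)
  have card_joins: "card (joins F G) = card F * card G" if "F \<subseteq> Pow Y1" "G \<subseteq> Pow Y2" for F G
  proof -
    have "inj_on (\<lambda>(A, B). A \<union> B) (F \<times> G)"
      by (rule inj_on_inverseI[of _ "\<lambda>C. (C \<inter> Y1, C \<inter> Y2)"]) (use that Int in blast)
    then show ?thesis unfolding joins_def by (simp add: card_image card_cartesian_product)
  qed
  have b1: "1 \<le> r1 (T \<inter> Y1)" "r1 (T \<inter> Y1) < k1" for T using p1.rank_pos p1.rank_less by auto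
  have b2: "1 \<le> r2 (T \<inter> Y2)" "r2 (T \<inter> Y2) < k2" for T using p2.rank_pos p2.rank_less by auto
  \<comment> \<open>Inclusion of joins is coordinatewise and proper in some coordinate. Arbitrary
    \<open>F\<close> and \<open>G\<close> let one argument cover small and large members.\<close>
  have strict: "?r A < ?r B" if AF: "A \<in> joins F G" and BF: "B \<in> joins F G" and "A \<subset> B"
    and FG: "F \<subseteq> Pow Y1" "G \<subseteq> Pow Y2"
    and F: "\<And>A B. A \<in> F \<Longrightarrow> B \<in> F \<Longrightarrow> A \<subset> B \<Longrightarrow> r1 A < r1 B"
    and G: "\<And>A B. A \<in> G \<Longrightarrow> B \<in> G \<Longrightarrow> A \<subset> B \<Longrightarrow> r2 A < r2 B" for A B F G
  proof -
    obtain A1 A2 where A: "A1 \<in> F" "A2 \<in> G" "A = A1 \<union> A2" "A \<inter> Y1 = A1" "A \<inter> Y2 = A2"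
      using joinsE[OF AF FG] by blast
    obtain B1 B2 where B: "B1 \<in> F" "B2 \<in> G" "B = B1 \<union> B2" "B \<inter> Y1 = B1" "B \<inter> Y2 = B2"
      using joinsE[OF BF FG] by blast
    have sub: "A1 \<subseteq> B1" "A2 \<subseteq> B2" using A(4,5) B(4,5) \<open>A \<subset> B\<close> by blast+
    have le: "r1 A1 \<le> r1 B1" "r2 A2 \<le> r2 B2"
      using sub p1.rank_mono p2.rank_mono B(4,5) by auto
    have "A1 \<subset> B1 \<or> A2 \<subset> B2" using sub A(3) B(3) \<open>A \<subset> B\<close> by blast
    then have "r1 A1 < r1 B1 \<or> r2 A2 < r2 B2" using F[OF A(1) B(1)] G[OF A(2) B(2)] by blast
    then show ?thesis using le b1[of A] b2[of A] unfolding A(4,5) B(4,5) by linarith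
  qed
  show "card (joins S1 S2) = card S1 * card S2" "card (joins L1 L2) = card L1 * card L2"
    using card_joins p1.small_sub p2.small_sub p1.large_sub p2.large_sub by auto
  show "pair_system (k1 + k2 - 2) (Y1 \<union> Y2) (joins S1 S2) (joins L1 L2) ?r"
  proof
    show "finite (Y1 \<union> Y2)" using p1.finite_ground p2.finite_ground by simp
    show "joins S1 S2 \<subseteq> Pow (Y1 \<union> Y2)" "joins L1 L2 \<subseteq> Pow (Y1 \<union> Y2)"
      using p1.small_sub p2.small_sub p1.large_sub p2.large_sub by (fastforce simp: joins_def)+
    show "1 \<le> ?r T" for T using b1[of T] b2[of T] by linarith
    show "?r T < k1 + k2 - 2" for T using b1[of T] b2[of T] by linarith
    show "?r T \<le> ?r U" if "T \<subseteq> U" for T U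
    proof -
      have "r1 (T \<inter> Y1) \<le> r1 (U \<inter> Y1)" "r2 (T \<inter> Y2) \<le> r2 (U \<inter> Y2)"
        using that by (auto intro!: p1.rank_mono p2.rank_mono)
      then show ?thesis by linarith
    qed
    show "?r A < ?r B" if "A \<in> joins S1 S2" "B \<in> joins S1 S2" "A \<subset> B" for A B
      by (rule strict[OF that p1.small_sub p2.small_sub p1.small_strict p2.small_strict])
    show "?r A < ?r B" if "A \<in> joins L1 L2" "B \<in> joins L1 L2" "A \<subset> B" for A B
      by (rule strict[OF that p1.large_sub p2.large_sub p1.large_strict p2.large_strict])
    show "\<exists>A\<in>joins S1 S2. A \<subseteq> T \<and> ?r A = ?r T" for T
    proof -
      obtain A where A: "A \<in> S1" "A \<subseteq> T \<inter> Y1" "r1 A = r1 (T \<inter> Y1)"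
        using p1.small_attained[of "T \<inter> Y1"] by blast
      obtain B where B: "B \<in> S2" "B \<subseteq> T \<inter> Y2" "r2 B = r2 (T \<inter> Y2)"
        using p2.small_attained[of "T \<inter> Y2"] by blast
      have "A \<union> B \<subseteq> T" using A B by blast
      moreover have "?r (A \<union> B) = ?r T" using Int[of A B] A B by simp
      ultimately show ?thesis using joinsI[OF A(1) B(1)] by blast
    qed
    show "\<exists>B\<in>joins L1 L2. T \<subseteq> B \<and> ?r B = ?r T" if "T \<subseteq> Y1 \<union> Y2" for T
    proof -
      obtain A where A: "A \<in> L1" "T \<inter> Y1 \<subseteq> A" "r1 A = r1 (T \<inter> Y1)"
        using p1.large_attained[of "T \<inter> Y1"] by blast
      obtain B where B: "B \<in> L2" "T \<inter> Y2 \<subseteq> B" "r2 B = r2 (T \<inter> Y2)"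
        using p2.large_attained[of "T \<inter> Y2"] by blast
      have "T \<subseteq> A \<union> B" using A B that by blast
      moreover have "A \<subseteq> Y1" "B \<subseteq> Y2" using A(1) B(1) p1.large_sub p2.large_sub by auto
      then have "?r (A \<union> B) = ?r T" using Int[of A B] A B by simp
      ultimately show ?thesis using joinsI[OF A(1) B(1)] by blast
    qed
    show "\<exists>B\<in>joins S1 S2. B \<subset> A \<and> Suc (?r B) = ?r A" if A: "A \<in> joins S1 S2" "2 \<le> ?r A" for A
    proof -
      obtain A1 A2 where eq: "A1 \<in> S1" "A2 \<in> S2" "A = A1 \<union> A2" "A \<inter> Y1 = A1" "A \<inter> Y2 = A2"
        using joinsE[OF A(1) p1.small_sub p2.small_sub] by blast
      have sub: "A1 \<subseteq> Y1" "A2 \<subseteq> Y2" using eq by auto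
      \<comment> \<open>The step is made in a coordinate that still has room, with the other one
        fixed.\<close>
      consider "2 \<le> r1 A1" | "2 \<le> r2 A2" using A(2) unfolding eq(4,5) by linarith
      then show ?thesis
      proof cases
        case 1
        then obtain B where B: "B \<in> S1" "B \<subset> A1" "Suc (r1 B) = r1 A1" using p1.small_step eq(1) by blast
        then have "?r (B \<union> A2) = r1 B + r2 A2 - 1" using Int[of B A2] sub by auto
        then have "Suc (?r (B \<union> A2)) = ?r A" using B(3) b2[of A] unfolding eq(4,5) by linarith
        moreover have "B \<union> A2 \<subset> A" using B(2) eq(3) sub disj by blast
        ultimately show ?thesis using joinsI[OF B(1) eq(2)] by blast
      next
        case 2
        then obtain B where B: "B \<in> S2" "B \<subset> A2" "Suc (r2 B) = r2 A2" using p2.small_step eq(2) by blast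
        then have "?r (A1 \<union> B) = r1 A1 + r2 B - 1" using Int[of A1 B] sub by auto
        then have "Suc (?r (A1 \<union> B)) = ?r A" using B(3) b1[of A] unfolding eq(4,5) by linarith
        moreover have "A1 \<union> B \<subset> A" using B(2) eq(3) sub disj by blast
        ultimately show ?thesis using joinsI[OF eq(1) B(1)] by blast
      qed
    qed
    show "\<exists>B\<in>joins L1 L2. A \<subset> B \<and> ?r B = Suc (?r A)"
      if A: "A \<in> joins L1 L2" "?r A + 2 \<le> k1 + k2 - 2" for A
    proof -
      obtain A1 A2 where eq: "A1 \<in> L1" "A2 \<in> L2" "A = A1 \<union> A2" "A \<inter> Y1 = A1" "A \<inter> Y2 = A2"
        using joinsE[OF A(1) p1.large_sub p2.large_sub] by blast
      have sub: "A1 \<subseteq> Y1" "A2 \<subseteq> Y2" using eq by auto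
      \<comment> \<open>If both coordinates had their maximal ranks \<open>k1 - 1\<close> and
        \<open>k2 - 1\<close>, then \<open>A\<close> would have rank \<open>k1 + k2 - 3\<close>,
        contrary to the bound.\<close>
      consider "r1 A1 + 2 \<le> k1" | "r2 A2 + 2 \<le> k2"
        using A(2) b1[of A] b2[of A] unfolding eq(4,5) by linarith
      then show ?thesis
      proof cases
        case 1
        then obtain B where B: "B \<in> L1" "A1 \<subset> B" "r1 B = Suc (r1 A1)" using p1.large_step eq(1) by blast
        have BY: "B \<subseteq> Y1" using B(1) p1.large_sub by auto
        then have "?r (B \<union> A2) = r1 B + r2 A2 - 1" using Int[of B A2] sub by auto
        then have "?r (B \<union> A2) = Suc (?r A)" using B(3) b2[of A] unfolding eq(4,5) by linarith
        moreover have "A \<subset> B \<union> A2" using B(2) eq(3) sub BY disj by blast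
        ultimately show ?thesis using joinsI[OF B(1) eq(2)] by blast
      next
        case 2
        then obtain B where B: "B \<in> L2" "A2 \<subset> B" "r2 B = Suc (r2 A2)" using p2.large_step eq(2) by blast
        have BY: "B \<subseteq> Y2" using B(1) p2.large_sub by auto
        then have "?r (A1 \<union> B) = r1 A1 + r2 B - 1" using Int[of A1 B] sub by auto
        then have "?r (A1 \<union> B) = Suc (?r A)" using B(3) b1[of A] unfolding eq(4,5) by linarith
        moreover have "A \<subset> A1 \<union> B" using B(2) eq(3) sub BY disj by blast
        ultimately show ?thesis using joinsI[OF eq(1) B(1)] by blast
      qed
    qed
  qed
qed

text \<open>The two sizes are kept apart because products multiply each of them exactly, which their
  sum does not record.\<close>

definition pair_sizes :: "nat \<Rightarrow> nat \<Rightarrow> nat \<Rightarrow> bool" where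
  "pair_sizes k s l \<longleftrightarrow> (\<exists>(Y :: nat set) S L r. pair_system k Y S L r \<and> card S = s \<and> card L = l)"

lemma pair_sizesI: "pair_system k (Y :: nat set) S L r \<Longrightarrow> pair_sizes k (card S) (card L)"
  unfolding pair_sizes_def by blast

lemma pair_sizes_mult:
  assumes "pair_sizes k1 s1 l1" "pair_sizes k2 s2 l2"
  shows "pair_sizes (k1 + k2 - 2) (s1 * s2) (l1 * l2)"
proof -
  obtain Y1 S1 L1 r1 where 1: "pair_system k1 (Y1 :: nat set) S1 L1 r1" "card S1 = s1" "card L1 = l1"
    using assms(1) unfolding pair_sizes_def by blast
  obtain Y2 S2 L2 r2 where 2: "pair_system k2 (Y2 :: nat set) S2 L2 r2" "card S2 = s2" "card L2 = l2"
    using assms(2) unfolding pair_sizes_def by blast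
  \<comment> \<open>Even and odd numbers hold disjoint copies of the two ground sets.\<close>
  have i: "inj_on (\<lambda>n. 2 * n) Y1" "inj_on (\<lambda>n. Suc (2 * n)) Y2" by (auto simp: inj_on_def)
  have d: "(\<lambda>n. 2 * n) ` Y1 \<inter> (\<lambda>n. Suc (2 * n)) ` Y2 = {}" by (auto; presburger)
  note p = pair_system_joins[OF pair_system_image(1)[OF 1(1) i(1)] pair_system_image(1)[OF 2(1) i(2)] d]
  show ?thesis
    using pair_sizesI[OF p(1)] unfolding p(2,3) pair_system_image(2,3)[OF 1(1) i(1)]
      pair_system_image(2,3)[OF 2(1) i(2)] 1(2,3) 2(2,3) .
qed

lemma pair_sat_le_sizes: "pair_sizes k s l \<Longrightarrow> pair_sat k \<le> s + l"
  unfolding pair_sizes_def using pair_sat_le by blast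

lemma pair_sat_sizes:
  assumes "2 \<le> k" obtains s l where "pair_sizes k s l" "pair_sat k = s + l"
  using pair_sat_attained[OF assms] unfolding pair_sizes_def by metis

text \<open>The product of optimal systems has \<open>s * s' + l * l'\<close> members, at most
  \<open>(s + l) * (s' + l')\<close>. The offset 2 makes the parameters additive.\<close>

lemma pair_sat_submultiplicative: "pair_sat (m + n + 2) \<le> pair_sat (m + 2) * pair_sat (n + 2)"
proof -
  obtain s l where 1: "pair_sizes (m + 2) s l" "pair_sat (m + 2) = s + l"
    using pair_sat_sizes[of "m + 2"] by auto
  obtain s' l' where 2: "pair_sizes (n + 2) s' l'" "pair_sat (n + 2) = s' + l'"
    using pair_sat_sizes[of "n + 2"] by auto
  have "pair_sizes (m + n + 2) (s * s') (l * l')"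
    using pair_sizes_mult[OF 1(1) 2(1)] by (simp add: algebra_simps)
  then have "pair_sat (m + n + 2) \<le> s * s' + l * l'" by (rule pair_sat_le_sizes)
  also have "\<dots> \<le> (s + l) * (s' + l')" by (simp add: algebra_simps)
  finally show ?thesis using 1 2 by simp
qed

section \<open>Covering the cube by intervals\<close>

context pair_system begin

text \<open>Each step down lowers the rank by one and removes at least one point, until rank 1 is
  reached.\<close>

lemma rank_le_card: "A \<in> S \<Longrightarrow> r A \<le> Suc (card A)"
proof (induction "r A" arbitrary: A rule: less_induct)
  case less
  show ?case
  proof (cases "2 \<le> r A")
    case True
    then obtain B where B: "B \<in> S" "B \<subset> A" "Suc (r B) = r A" using small_step less.prems by blast
    have "finite A" using less.prems small_sub finite_ground finite_subset by blast
    then have "card B < card A" using B(2) psubset_card_mono by blast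
    then show ?thesis using less.hyps[of B] B by linarith
  qed auto
qed

lemma corank_le_card: "B \<in> L \<Longrightarrow> k - r B \<le> Suc (card (Y - B))"
proof (induction "k - r B" arbitrary: B rule: less_induct)
  case less
  show ?case
  proof (cases "r B + 2 \<le> k")
    case True
    then obtain C where C: "C \<in> L" "B \<subset> C" "r C = Suc (r B)" using large_step less.prems by blast
    have "Y - C \<subset> Y - B" using C large_sub by blast
    then have "card (Y - C) < card (Y - B)" using finite_ground psubset_card_mono by blast
    moreover have "k - r C < k - r B" using C(3) True by linarith
    ultimately show ?thesis using less.hyps[of C] C by linarith
  qed auto
qed

text \<open>For \<open>A \<subseteq> B\<close> of equal rank, \<open>A\<close> has at least
  \<open>r A - 1\<close> points and \<open>B\<close> omits at least \<open>k - r B - 1\<close>, so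
  the interval between them has at most \<open>2 ^ (card Y - (k - 2))\<close> sets. Such intervals
  cover \<open>Pow Y\<close>, so at least \<open>2 ^ (k - 2)\<close> pairs are needed.\<close>

lemma power_le_card_mult: "2 ^ (k - 2) \<le> card S * card L"
proof -
  define P where "P = {(A, B) \<in> S \<times> L. A \<subseteq> B \<and> r A = r B}"
  define I where "I = (\<lambda>(A, B). {T. A \<subseteq> T \<and> T \<subseteq> B} :: 'a set set)"
  have P: "P \<subseteq> S \<times> L" by (auto simp: P_def)
  then have finP: "finite P" using finite_small finite_large finite_subset by blast
  have I: "card (I p) * 2 ^ (k - 2) \<le> 2 ^ card Y" if p: "p \<in> P" for p
  proof -
    obtain A B where AB: "p = (A, B)" "A \<in> S" "B \<in> L" "A \<subseteq> B" "r A = r B" using p by (auto simp: P_def)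
    have fin: "finite B" "B \<subseteq> Y" using AB(3) large_sub finite_ground finite_subset by blast+
    have "I p \<subseteq> (\<lambda>U. U \<union> A) ` Pow (B - A)"
    proof
      fix T assume "T \<in> I p"
      then have "T = (T - A) \<union> A" "T - A \<in> Pow (B - A)" by (auto simp: I_def AB(1))
      then show "T \<in> (\<lambda>U. U \<union> A) ` Pow (B - A)" by blast
    qed
    then have "card (I p) \<le> card (Pow (B - A))"
      using fin by (meson card_image_le card_mono finite_Diff finite_Pow_iff finite_imageI order_trans)
    then have le: "card (I p) \<le> 2 ^ card (B - A)" using fin by (simp add: card_Pow)
    have "card B = card A + card (B - A)" "card Y = card B + card (Y - B)"
      using AB(4) fin finite_ground by (metis card_Diff_subset card_mono finite_subset le_add_diff_inverse)+
    moreover have "r B < k" using rank_less fin by blast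
    ultimately have "card (B - A) + (k - 2) \<le> card Y"
      using rank_le_card[OF AB(2)] corank_le_card[OF AB(3)] AB(5) by linarith
    then have "(2::nat) ^ card (B - A) * 2 ^ (k - 2) \<le> 2 ^ card Y"
      by (simp flip: power_add)
    then show ?thesis using le by (meson mult_le_mono1 order_trans)
  qed
  have "Pow Y \<subseteq> (\<Union>p\<in>P. I p)"
  proof
    fix T assume "T \<in> Pow Y"
    then obtain A B where AB: "A \<in> S" "A \<subseteq> T" "r A = r T" "B \<in> L" "T \<subseteq> B" "r B = r T"
      using small_attained[of T] large_attained[of T] by blast
    then have "(A, B) \<in> P" "T \<in> I (A, B)" by (auto simp: P_def I_def)
    then show "T \<in> (\<Union>p\<in>P. I p)" by blast
  qed
  moreover have "finite (I p)" if "p \<in> P" for p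
  proof -
    have "I p \<subseteq> Pow Y" using that large_sub by (auto simp: I_def P_def)
    then show ?thesis using finite_ground finite_subset by blast
  qed
  ultimately have "2 ^ card Y \<le> card (\<Union>p\<in>P. I p)"
    using finP finite_ground by (metis card_Pow card_mono finite_UN)
  also have "\<dots> \<le> (\<Sum>p\<in>P. card (I p))" by (rule card_UN_le[OF finP])
  finally have "2 ^ card Y * 2 ^ (k - 2) \<le> (\<Sum>p\<in>P. card (I p) * 2 ^ (k - 2))"
    by (simp add: sum_distrib_right[symmetric])
  also have "\<dots> \<le> (\<Sum>p\<in>P. 2 ^ card Y)" by (rule sum_mono[OF I])
  finally have "2 ^ card Y * 2 ^ (k - 2) \<le> 2 ^ card Y * card P" by (simp add: mult.commute)
  then have "2 ^ (k - 2) \<le> card P" by simp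
  also have "\<dots> \<le> card (S \<times> L)" using P finite_small finite_large by (intro card_mono) auto
  finally show ?thesis by (simp add: card_cartesian_product)
qed

end

text \<open>The inequality \<open>4 * s * l \<le> (s + l)\<^sup>2\<close> passes from the product to
  the sum; the factor 4 raises the exponent from \<open>k - 2\<close> to \<open>k\<close>.\<close>

lemma power_le_pair_sat_square:
  assumes "2 \<le> k" shows "2 ^ k \<le> (pair_sat k)\<^sup>2"
proof -
  obtain Y S L r where *: "pair_system k (Y :: nat set) S L r" "pair_sat k = card S + card L"
    using pair_sat_attained[OF assms] .
  have "(2::nat) ^ k = 2 ^ 2 * 2 ^ (k - 2)" using assms by (metis le_add_diff_inverse power_add)
  also have "\<dots> \<le> 4 * (card S * card L)" using pair_system.power_le_card_mult[OF *(1)] by simp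
  also have "\<dots> \<le> (card S + card L)\<^sup>2"
  proof -
    \<comment> \<open>Integers are used because the proof needs the square of a difference.\<close>
    have "int (4 * (card S * card L)) \<le> int ((card S + card L)\<^sup>2)"
      using zero_le_power2[of "int (card S) - int (card L)"]
      by (simp add: power2_eq_square algebra_simps)
    then show ?thesis by linarith
  qed
  finally show ?thesis using *(2) by simp
qed

section \<open>A saturated 6-Sperner system with 30 members\<close>

text \<open>Found by a SAT solver.  Each set is listed together with its rank.\<close>

definition ex_small :: "(nat \<times> nat list) list" where
  "ex_small =
    [(1, []), (2, [0]), (2, [1]), (2, [3]), (2, [5]),
     (3, [1,2]), (3, [0,4]), (3, [3,4]), (3, [0,5]), (3, [3,5]),
     (4, [0,1,2]), (4, [1,2,3]), (4, [0,4,5]), (4, [3,4,5]), (5, [0,1,2,4])]"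

definition ex_large :: "(nat \<times> nat list) list" where
  "ex_large =
    [(1, [2,4]), (2, [0,1,3]), (2, [0,2,3]), (2, [1,4,5]), (2, [2,4,5]),
     (3, [0,1,3,4]), (3, [0,2,3,4]), (3, [0,1,3,5]), (3, [0,2,3,5]), (3, [1,2,4,5]),
     (4, [0,1,2,3,5]), (4, [0,1,3,4,5]), (4, [0,2,3,4,5]), (4, [1,2,3,4,5]), (5, [0,1,2,3,4,5])]"

text \<open>An executable rank: for \<open>T\<close> in the ground set it is meant to equal the
  length of a longest chain of small sets below \<open>T\<close>. The entry \<open>(1, [])\<close>
  keeps the maximum over a nonempty set.\<close>

definition ex_rank :: "nat set \<Rightarrow> nat" where
  "ex_rank T = Max (set (map fst (filter (\<lambda>p. set (snd p) \<subseteq> T) ex_small)))"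

lemma ex_rank_listed:
  "\<forall>p\<in>set (ex_small @ ex_large). ex_rank (set (snd p)) = fst p \<and> set (snd p) \<subseteq> {..<6}"
  by code_simp

text \<open>Phrased for lists, so that the conditions on all 64 subsets can be evaluated along
  \<open>subseqs\<close>.\<close>

definition ex_attained :: "nat \<Rightarrow> nat list \<Rightarrow> bool" where
  "ex_attained i xs \<longleftrightarrow> 1 \<le> i \<and> i < 6 \<and> (\<exists>p\<in>set ex_small. fst p = i \<and> set (snd p) \<subseteq> set xs) \<and>
     (\<exists>p\<in>set ex_large. fst p = i \<and> set xs \<subseteq> set (snd p))"

lemma ex_attained: "\<forall>xs\<in>set (subseqs [0,1,2,3,4,5]). ex_attained (ex_rank (set xs)) xs"
  by code_simp

lemma ex_strict:
  "\<forall>p\<in>set ex_small. \<forall>q\<in>set ex_small. set (snd p) \<subset> set (snd q) \<longrightarrow> fst p < fst q"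
  "\<forall>p\<in>set ex_large. \<forall>q\<in>set ex_large. set (snd p) \<subset> set (snd q) \<longrightarrow> fst p < fst q"
  by code_simp+

lemma ex_step:
  "\<forall>p\<in>set ex_small. 2 \<le> fst p \<longrightarrow> (\<exists>q\<in>set ex_small. set (snd q) \<subset> set (snd p) \<and> Suc (fst q) = fst p)"
  "\<forall>p\<in>set ex_large. fst p + 2 \<le> 6 \<longrightarrow> (\<exists>q\<in>set ex_large. set (snd p) \<subset> set (snd q) \<and> fst q = Suc (fst p))"
  by code_simp+

lemma ex_distinct:
  "card ((set \<circ> snd) ` set ex_small) = 15" "card ((set \<circ> snd) ` set ex_large) = 15"
  by code_simp+

lemma ex_pair_system:
  "pair_system 6 {..<6} ((set \<circ> snd) ` set ex_small) ((set \<circ> snd) ` set ex_large) ex_rank"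
proof -
  have ground: "{..<6::nat} = set [0,1,2,3,4,5]" by code_simp
  have sub: "set (snd p) \<subseteq> {..<6}" and rank: "ex_rank (set (snd p)) = fst p"
    if "p \<in> set ex_small \<or> p \<in> set ex_large" for p
    using ex_rank_listed that by auto
  have att: "1 \<le> ex_rank T" "ex_rank T < 6"
    "\<exists>p\<in>set ex_small. fst p = ex_rank T \<and> set (snd p) \<subseteq> T"
    "\<exists>p\<in>set ex_large. fst p = ex_rank T \<and> T \<subseteq> set (snd p)" if "T \<subseteq> {..<6}" for T
  proof -
    have "T \<in> set ` set (subseqs [0,1,2,3,4,5])"
      using that unfolding ground subseqs_powset by blast
    then obtain xs where "xs \<in> set (subseqs [0,1,2,3,4,5])" "T = set xs" by blast
    then have "ex_attained (ex_rank T) xs" "T = set xs" using ex_attained by blast+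
    then show "1 \<le> ex_rank T" "ex_rank T < 6"
      "\<exists>p\<in>set ex_small. fst p = ex_rank T \<and> set (snd p) \<subseteq> T"
      "\<exists>p\<in>set ex_large. fst p = ex_rank T \<and> T \<subseteq> set (snd p)"
      unfolding ex_attained_def by blast+
  qed
  show ?thesis
  proof
    show "(set \<circ> snd) ` set ex_small \<subseteq> Pow {..<6}" "(set \<circ> snd) ` set ex_large \<subseteq> Pow {..<6}"
      using sub by auto
    show "ex_rank T \<le> ex_rank U" if "T \<subseteq> U" for T U
      unfolding ex_rank_def
    proof (rule Max_mono)
      show "set (map fst (filter (\<lambda>p. set (snd p) \<subseteq> T) ex_small)) \<noteq> {}"
        by (simp add: ex_small_def)
    qed (use that in auto)
    show "ex_rank A < ex_rank B"
      if AB: "A \<in> (set \<circ> snd) ` set ex_small" "B \<in> (set \<circ> snd) ` set ex_small" "A \<subset> B" for A B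
    proof -
      obtain p q where "p \<in> set ex_small" "q \<in> set ex_small" "A = set (snd p)" "B = set (snd q)"
        using AB(1,2) by auto
      then show ?thesis using ex_strict(1) AB(3) by (simp add: rank)
    qed
    show "ex_rank A < ex_rank B"
      if AB: "A \<in> (set \<circ> snd) ` set ex_large" "B \<in> (set \<circ> snd) ` set ex_large" "A \<subset> B" for A B
    proof -
      obtain p q where "p \<in> set ex_large" "q \<in> set ex_large" "A = set (snd p)" "B = set (snd q)"
        using AB(1,2) by auto
      then show ?thesis using ex_strict(2) AB(3) by (simp add: rank)
    qed
    show "\<exists>A\<in>(set \<circ> snd) ` set ex_small. A \<subseteq> T \<and> ex_rank A = ex_rank T" if "T \<subseteq> {..<6}" for T
      using att(3)[OF that] by (auto simp: rank)
    show "\<exists>B\<in>(set \<circ> snd) ` set ex_large. T \<subseteq> B \<and> ex_rank B = ex_rank T" if "T \<subseteq> {..<6}" for T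
      using att(4)[OF that] by (auto simp: rank)
    show "\<exists>B\<in>(set \<circ> snd) ` set ex_small. B \<subset> A \<and> Suc (ex_rank B) = ex_rank A"
      if A: "A \<in> (set \<circ> snd) ` set ex_small" "2 \<le> ex_rank A" for A
    proof -
      obtain p where p: "p \<in> set ex_small" "A = set (snd p)" using A(1) by auto
      then have "2 \<le> fst p" using A(2) rank by auto
      then obtain q where "q \<in> set ex_small" "set (snd q) \<subset> A" "Suc (fst q) = fst p"
        using ex_step(1) p by blast
      then show ?thesis using p by (intro bexI[of _ "set (snd q)"]) (auto simp: rank)
    qed
    show "\<exists>B\<in>(set \<circ> snd) ` set ex_large. A \<subset> B \<and> ex_rank B = Suc (ex_rank A)"
      if A: "A \<in> (set \<circ> snd) ` set ex_large" "ex_rank A + 2 \<le> 6" for A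
    proof -
      obtain p where p: "p \<in> set ex_large" "A = set (snd p)" using A(1) by auto
      then have "fst p + 2 \<le> 6" using A(2) rank by auto
      then obtain q where "q \<in> set ex_large" "A \<subset> set (snd q)" "fst q = Suc (fst p)"
        using ex_step(2) p by blast
      then show ?thesis using p by (intro bexI[of _ "set (snd q)"]) (auto simp: rank)
    qed
  qed (use att in auto)
qed

text \<open>Induction by products with the 6-Sperner example, each adding 4 to the parameter, from
  the one-point cube with one small and one large member.\<close>

lemma pair_sizes_example_power: "pair_sizes (4 * j + 2) (15 ^ j) (15 ^ j)"
proof (induction j)
  case 0
  show ?case using pair_sizesI[OF pair_system_boolean[of 2]] by (simp add: numeral_2_eq_2)
next
  case (Suc j)
  have "pair_sizes 6 15 15" using pair_sizesI[OF ex_pair_system] unfolding ex_distinct .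
  from pair_sizes_mult[OF this Suc] show ?case by (simp add: algebra_simps)
qed

text \<open>The total \<open>2 * 15 ^ j\<close> first drops below \<open>16 ^ j\<close> at
  \<open>j = 11\<close>; a single copy with 30 members still exceeds 16.\<close>

lemma pair_sat_46: "pair_sat 46 < 2 ^ 44"
proof -
  have "pair_sat 46 \<le> 15 ^ 11 + 15 ^ 11"
    using pair_sat_le_sizes[OF pair_sizes_example_power[of 11]] by simp
  also have "\<dots> < 2 ^ 44" by simp
  finally show ?thesis .
qed

section \<open>Growth rate\<close>

text \<open>The limit is the infimum of \<open>a n / n\<close>, which nonnegativity bounds below.
  Division of \<open>n\<close> by a fixed \<open>m\<close> that nearly attains it bounds the ratio
  from above.\<close>

lemma Fekete:
  fixes a :: "nat \<Rightarrow> real"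
  assumes sub: "\<And>m n. a (m + n) \<le> a m + a n" and nonneg: "\<And>n. 0 \<le> a n"
  obtains c where "(\<lambda>n. a n / n) \<longlonglongrightarrow> c" "\<And>n. 1 \<le> n \<Longrightarrow> c \<le> a n / n"
proof -
  define c where "c = (INF n\<in>{1..}. a n / real n)"
  have bdd: "bdd_below ((\<lambda>n. a n / real n) ` {1..})" using nonneg by (intro bdd_belowI2[of _ 0]) auto
  have c_le: "c \<le> a n / n" if "1 \<le> n" for n unfolding c_def using bdd that by (intro cINF_lower) auto
  have mult: "a (q * m + s) \<le> q * a m + a s" for q m s
  proof (induction q)
    case (Suc q)
    have "a (Suc q * m + s) \<le> a m + a (q * m + s)" using sub[of m "q * m + s"] by (simp add: algebra_simps)
    then show ?case using Suc by (simp add: algebra_simps)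
  qed simp
  have "(\<lambda>n. a n / n) \<longlonglongrightarrow> c"
  proof (rule LIMSEQ_I)
    fix \<epsilon> :: real assume "0 < \<epsilon>"
    then have "c < c + \<epsilon> / 2" by simp
    then obtain m where m: "1 \<le> m" "a m / m < c + \<epsilon> / 2"
      using cINF_less_iff[OF _ bdd, of "c + \<epsilon> / 2"] unfolding c_def[symmetric] by auto
    \<comment> \<open>A bound for all remainders modulo \<open>m\<close>; dividing it by a large
      \<open>n\<close> makes it negligible.\<close>
    define M where "M = (\<Sum>s<m. a s)"
    have M: "a s \<le> M" if "s < m" for s
      unfolding M_def using that nonneg by (intro member_le_sum) auto
    obtain N :: nat where N: "2 * M / \<epsilon> < N" using reals_Archimedean2 by blast
    show "\<exists>no. \<forall>n\<ge>no. norm (a n / n - c) < \<epsilon>"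
    proof (intro exI allI impI)
      fix n assume n: "Suc N \<le> n"
      define q where "q = n div m"
      have "a n \<le> q * a m + a (n mod m)" using mult[of q m "n mod m"] by (simp add: q_def)
      also have "a (n mod m) \<le> M" using M m(1) by simp
      also have "q * a m \<le> n / m * a m"
      proof -
        have "real q \<le> n / m" unfolding q_def by (rule of_nat_div_le_of_nat)
        then show ?thesis using nonneg by (intro mult_right_mono)
      qed
      finally have "a n / n \<le> (n / m * a m + M) / n" by (simp add: divide_right_mono)
      also have "\<dots> = a m / m + M / n" using n by (simp add: field_simps)
      also have "M / n < \<epsilon> / 2"
      proof -
        have "2 * M / \<epsilon> < n" using N n by linarith
        then show ?thesis using \<open>0 < \<epsilon>\<close> n by (simp add: field_simps)
      qed
      finally have "a n / n < c + \<epsilon>" using m(2) by linarith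
      then show "norm (a n / n - c) < \<epsilon>" using c_le[of n] n \<open>0 < \<epsilon>\<close> by (simp add: abs_if)
    qed
  qed
  then show ?thesis using that c_le by blast
qed

theorem theorem1p4:
  "\<exists>\<epsilon>::real. \<epsilon> > 0 \<and>
     (\<exists>c::real. c \<in> {1/2..1 - \<epsilon>} \<and>
        (\<forall>k::nat. k \<ge> 1 \<longrightarrow> sat_lim k \<le> 2 powr ((1 - \<epsilon>) * real k)) \<and>
        (\<exists>\<delta> :: nat \<Rightarrow> real. \<delta> \<in> o(\<lambda>_. 1) \<and>
           (\<forall>\<^sub>F k in sequentially. sat_lim k = 2 powr ((1 + \<delta> k) * c * real k))))"
proof -
  \<comment> \<open>The shift by 2 turns submultiplicativity into subadditivity.\<close>
  define a where "a n = log 2 (real (pair_sat (n + 2)))" for n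
  have sq: "2 ^ k \<le> (real (pair_sat k))\<^sup>2" if "2 \<le> k" for k
    using power_le_pair_sat_square[OF that] by (metis of_nat_le_iff of_nat_numeral of_nat_power)
  have pos: "0 < pair_sat k" if "2 \<le> k" for k
  proof (rule ccontr)
    assume "\<not> 0 < pair_sat k"
    then show False using power_le_pair_sat_square[OF that] by simp
  qed
  have a_lower: "real n / 2 \<le> a n" for n
  proof -
    have "real (n + 2) = log 2 (2 ^ (n + 2))" by (subst log_nat_power) auto
    also have "\<dots> \<le> log 2 ((real (pair_sat (n + 2)))\<^sup>2)"
      using sq[of "n + 2"] pos[of "n + 2"] by (subst log_le_cancel_iff) auto
    also have "\<dots> = 2 * a n" unfolding a_def using pos[of "n + 2"] by (subst log_nat_power) auto
    finally show ?thesis by simp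
  qed
  have nonneg: "0 \<le> a n" for n using a_lower[of n] by (simp add: order_trans[rotated])
  have sub: "a (m + n) \<le> a m + a n" for m n
  proof -
    have "real (pair_sat (m + n + 2)) \<le> real (pair_sat (m + 2)) * real (pair_sat (n + 2))"
      using pair_sat_submultiplicative[of m n] by (metis of_nat_le_iff of_nat_mult)
    then have "a (m + n) \<le> log 2 (real (pair_sat (m + 2)) * real (pair_sat (n + 2)))"
      unfolding a_def using pos by (subst log_le_cancel_iff) auto
    also have "\<dots> = a m + a n" unfolding a_def using pos[of "m + 2"] pos[of "n + 2"] by (simp add: log_mult)
    finally show ?thesis .
  qed
  obtain c where lim: "(\<lambda>n. a n / n) \<longlonglongrightarrow> c" and c_le: "\<And>n. 1 \<le> n \<Longrightarrow> c \<le> a n / n"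
    using Fekete[of a, OF sub nonneg] by blast
  have c_ge: "1 / 2 \<le> c"
  proof (rule LIMSEQ_le_const[OF lim], intro exI allI impI)
    fix n :: nat assume "1 \<le> n"
    then show "1 / 2 \<le> a n / n" using a_lower[of n] by (simp add: field_simps)
  qed
  \<comment> \<open>Since \<open>c\<close> lies below every ratio \<open>a n / n\<close>, the single
    value \<open>n = 44\<close> suffices.\<close>
  have c_less: "c < 1"
  proof -
    have "real (pair_sat 46) < 2 ^ 44" using pair_sat_46 by (metis of_nat_less_iff of_nat_numeral of_nat_power)
    then have "a 44 < log 2 (2 ^ 44)" unfolding a_def using pos[of 46] by (subst log_less_cancel_iff) auto
    also have "\<dots> = 44" by (subst log_nat_power) auto
    finally show ?thesis using c_le[of 44] by simp
  qed
  \<comment> \<open>The rate in terms of \<open>k\<close> itself; replacing the denominator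
    \<open>n\<close> by \<open>n + 2\<close> does not change the limit.\<close>
  define b where "b k = log 2 (sat_lim k) / k" for k
  have b_eq: "sat_lim k = 2 powr (b k * k)" if "2 \<le> k" for k
    using that pos[OF that] by (simp add: b_def sat_lim_eq_pair_sat)
  have b_shift: "b (n + 2) = (a n / n) * (n / (n + 2))" if "1 \<le> n" for n
    using that by (simp add: b_def a_def sat_lim_eq_pair_sat)
  have "(\<lambda>n. real n / (n + 2)) \<longlonglongrightarrow> 1"
  proof -
    have "(\<lambda>n. 1 - 2 / real (n + 2)) \<longlonglongrightarrow> 1 - 0"
      by (intro tendsto_diff tendsto_const LIMSEQ_ignore_initial_segment[of "\<lambda>n. 2 / real n"] lim_const_over_n)
    moreover have "1 - 2 / real (n + 2) = real n / (n + 2)" for n by (simp add: field_simps)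
    ultimately show ?thesis by simp
  qed
  then have "(\<lambda>n. (a n / n) * (real n / (n + 2))) \<longlonglongrightarrow> c * 1" by (intro tendsto_mult lim)
  then have "(\<lambda>n. b (n + 2)) \<longlonglongrightarrow> c * 1"
    by (rule Lim_transform_eventually)
       (use b_shift in \<open>auto simp: eventually_sequentially intro!: exI[of _ 1]\<close>)
  then have b_lim: "b \<longlonglongrightarrow> c" using LIMSEQ_offset[of b 2 c] by simp
  have "\<forall>\<^sub>F k in sequentially. b k < (1 + c) / 2"
    using order_tendstoD(2)[OF b_lim, of "(1 + c) / 2"] c_less by simp
  then obtain K0 where K0: "\<And>k. K0 \<le> k \<Longrightarrow> b k < (1 + c) / 2" by (auto simp: eventually_sequentially)
  define K where "K = max K0 2"
  \<comment> \<open>The first term serves \<open>k \<ge> K\<close>, where the rate is below the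
    midpoint of \<open>c\<close> and 1. For smaller \<open>k\<close> the second gives
    \<open>\<epsilon> * k \<le> 1\<close>, so the bound \<open>2 ^ (k - 1)\<close> is
    enough.\<close>
  define \<epsilon> where "\<epsilon> = min ((1 - c) / 2) (1 / K)"
  have "0 < \<epsilon>" using c_less by (simp add: \<epsilon>_def K_def)
  moreover have "c \<in> {1/2..1 - \<epsilon>}"
  proof -
    have "\<epsilon> \<le> (1 - c) / 2" unfolding \<epsilon>_def by (rule min.cobounded1)
    then show ?thesis using c_ge c_less by simp
  qed
  moreover have "sat_lim k \<le> 2 powr ((1 - \<epsilon>) * k)" if k: "1 \<le> k" for k
  proof (cases "K \<le> k")
    case True
    then have "b k < (1 + c) / 2" "2 \<le> k" using K0 by (auto simp: K_def)
    moreover have "\<epsilon> \<le> (1 - c) / 2" unfolding \<epsilon>_def by (rule min.cobounded1)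
    ultimately have "b k * k \<le> (1 - \<epsilon>) * k" by (intro mult_right_mono) (auto simp: field_simps)
    then show ?thesis using b_eq[OF \<open>2 \<le> k\<close>] by simp
  next
    case False
    have "sat_lim k \<le> 2 ^ (k - 1)"
    proof (cases "k = 1")
      case True
      then show ?thesis using sat_lim_one by simp
    next
      case False
      then have "2 \<le> k" using k by simp
      then show ?thesis using pair_sat_le_power[of k]
        by (metis of_nat_le_iff of_nat_numeral of_nat_power sat_lim_eq_pair_sat)
    qed
    also have "\<dots> = 2 powr (real k - 1)" using k by (simp flip: powr_realpow add: of_nat_diff)
    also have "\<dots> \<le> 2 powr ((1 - \<epsilon>) * k)"
    proof -
      have "\<epsilon> * k \<le> 1 / K * K" using False \<open>0 < \<epsilon>\<close> by (intro mult_mono) (auto simp: \<epsilon>_def)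
      also have "\<dots> = 1" by (simp add: K_def)
      finally show ?thesis by (simp add: algebra_simps)
    qed
    finally show ?thesis .
  qed
  moreover have "\<exists>\<delta> :: nat \<Rightarrow> real. \<delta> \<in> o(\<lambda>_. 1) \<and>
      (\<forall>\<^sub>F k in sequentially. sat_lim k = 2 powr ((1 + \<delta> k) * c * real k))"
  proof (intro exI conjI)
    \<comment> \<open>This error term is chosen so that \<open>(1 + \<delta> k) * c\<close> equals
      \<open>b k\<close> exactly; \<open>c \<ge> 1/2\<close> permits the division.\<close>
    have "(\<lambda>k. b k / c - 1) \<longlonglongrightarrow> c / c - 1" using c_ge by (intro tendsto_intros b_lim) auto
    then show "(\<lambda>k. b k / c - 1) \<in> o(\<lambda>_. 1)" using c_ge by (intro smalloI_tendsto) auto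
    show "\<forall>\<^sub>F k in sequentially. sat_lim k = 2 powr ((1 + (b k / c - 1)) * c * real k)"
      using b_eq c_ge by (auto simp: eventually_sequentially intro!: exI[of _ 2])
  qed
  ultimately show ?thesis by blast
qed

end
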